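(* Let $p$ be a prime number. Let $R$ be a commutative ring with identity of characteristic zero (i.e. $R \to R\otimes\mathbb{Q}$ is injective), endowed with a $p$th power Frobenius endomorphism $\sigma: R\to R$, i.e. a ring endomorphism with $\sigma(r)\equiv r^p \bmod pR$ for every $r\in R$. Let $\{b_n;\, n\ge 0\}$ be a sequence of elements of $R$ with $b_0=1$. Put $f(x)=\sum_{n=1}^{\infty}\frac{b_{n-1}}{n}x^n \in (R\otimes\mathbb{Q})[[x]]$. Then the formal group law $F(x,y)=f^{-1}(f(x)+f(y))$ (where $f^{-1}$ is the compositional inverse of $f$) has coefficients in $R\otimes\mathbb{Z}_{(p)}$ if and only if the $p$-sequence $\{c_n;\, n\ge 0\}$ associated to $\{b_n;\, n\ge 0\}$ satisfies $$c_{mp^k-1}\in p^kR\quad\text{ for all integers } m>1,\ k\ge 0.$$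
   Context: For an integer $n\ge 0$ let $\ell(n)=\min\{s\ge 1 : n<p^s\}$ be the length of the $p$-adic expansion of $n$ (so $\ell(0)=1$). For integers $n,m\ge 0$ put $n*m=n+m\,p^{\ell(n)}$ (concatenation of $p$-adic expansions); one has $\ell(n*m)=\ell(n)+\ell(m)$ if and only if $m>0$. The $p$-sequence associated to a sequence $\{b_n;\,n\ge0\}$ of elements of $R$ is the sequence of elements of $R$ given, for $n\ge0$, by $$c_n=\sum (-1)^{k-1}\, b_{n_1}\cdot\sigma^{\ell(n_1)}(b_{n_2})\cdot\sigma^{\ell(n_1)+\ell(n_2)}(b_{n_3})\cdots\sigma^{\ell(n_1)+\cdots+\ell(n_{k-1})}(b_{n_k}),$$ where the sum runs over all $k\ge1$ and all tuples $(n_1,\dots,n_k)$ of integers with $n=n_1*\cdots*n_k$, $n_1\ge0$ and $n_2,\dots,n_k>0$ (the term $k=1$ is $b_n$; the operation is associative on such tuples). *)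

theory Defs
  imports "HOL-Computational_Algebra.Computational_Algebra"
begin

section \<open>The ring \<open>R \<otimes> \<rat>\<close> as fractions with integer denominators\<close>

text \<open>The integer \<open>k\<close> below is needed because \<open>R\<close> may have zero divisors and, at this point, torsion.\<close>

context comm_ring_1
begin

definition intfracrel :: "'a \<times> int \<Rightarrow> 'a \<times> int \<Rightarrow> bool" where
  "intfracrel x y \<longleftrightarrow> snd x \<noteq> 0 \<and> snd y \<noteq> 0 \<and>
     (\<exists>k. k \<noteq> 0 \<and> of_int k * (of_int (snd y) * fst x) = of_int k * (of_int (snd x) * fst y))"

lemma intfracrelI:
  "snd x \<noteq> 0 \<Longrightarrow> snd y \<noteq> 0 \<Longrightarrow> of_int (snd y) * fst x = of_int (snd x) * fst y \<Longrightarrow>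
    intfracrel x y"
  unfolding intfracrel_def by (intro conjI exI[of _ "1::int"]) simp_all

lemma part_equivp_intfracrel: "part_equivp intfracrel"
proof (rule part_equivpI)
  show "\<exists>x. intfracrel x x"
    by (rule exI[of _ "(0, 1 :: int)"]) (simp add: intfracrelI)
  show "symp intfracrel"
  proof (rule sympI)
    fix x y
    assume "intfracrel x y"
    then show "intfracrel y x"
      unfolding intfracrel_def by (metis (lifting))
  qed
  show "transp intfracrel"
  proof (rule transpI, unfold split_paired_all)
    fix a b c :: 'a and l m n :: int
    assume A: "intfracrel (a, l) (b, m)" and B: "intfracrel (b, m) (c, n)"
    from A obtain j where j: "j \<noteq> 0" "of_int j * (of_int m * a) = of_int j * (of_int l * b)"
      by (auto simp: intfracrel_def)
    from B obtain k where k: "k \<noteq> 0" "of_int k * (of_int n * b) = of_int k * (of_int m * c)"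
      by (auto simp: intfracrel_def)
    have "of_int (j * k * m) * (of_int n * a) = of_int (k * n) * (of_int j * (of_int m * a))"
      by (simp add: mult_ac)
    also have "\<dots> = of_int (j * l) * (of_int k * (of_int n * b))"
      unfolding j(2) by (simp add: mult_ac)
    also have "\<dots> = of_int (j * k * m) * (of_int l * c)"
      unfolding k(2) by (simp add: mult_ac)
    finally show "intfracrel (a, l) (c, n)"
      using A B j(1) k(1) by (auto simp: intfracrel_def intro!: exI[of _ "j * k * m"])
  qed
qed

end

quotient_type (overloaded) 'a rat_ext = "'a::comm_ring_1 \<times> int" / partial: intfracrel
  by (rule part_equivp_intfracrel)

text \<open>\<open>ifrac r n\<close> is \<open>r \<otimes> 1/n\<close>, that is \<open>r/n\<close>; the value for \<open>n = 0\<close> is a dummy.\<close>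

lift_definition ifrac :: "'a::comm_ring_1 \<Rightarrow> int \<Rightarrow> 'a rat_ext"
  is "\<lambda>r n. if n = 0 then (0, 1) else (r, n)"
  by (auto intro!: intfracrelI)

lemma ifrac_cases [cases type: rat_ext]:
  obtains r n where "q = ifrac r n" "n \<noteq> 0"
  by transfer (auto simp: intfracrel_def split: if_splits)

lemma ifrac_eq_iff:
  assumes "m \<noteq> 0" "n \<noteq> 0"
  shows "ifrac r m = ifrac s n \<longleftrightarrow>
    (\<exists>k. k \<noteq> 0 \<and> of_int k * (of_int n * r) = of_int k * (of_int m * s))"
  using assms by transfer (auto simp: intfracrel_def)

lemma ifrac_eqI:
  assumes "m \<noteq> 0" "n \<noteq> 0" "of_int n * r = of_int m * s"
  shows "ifrac r m = ifrac s n"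
  unfolding ifrac_eq_iff[OF assms(1,2)] by (rule exI[of _ 1]) (simp add: assms)

instantiation rat_ext :: (comm_ring_1) "{comm_ring, one}"
begin

lift_definition zero_rat_ext :: "'a rat_ext" is "(0, 1)"
  by (auto intro!: intfracrelI)

lift_definition one_rat_ext :: "'a rat_ext" is "(1, 1)"
  by (auto intro!: intfracrelI)

lift_definition plus_rat_ext :: "'a rat_ext \<Rightarrow> 'a rat_ext \<Rightarrow> 'a rat_ext"
  is "\<lambda>x y. (of_int (snd y) * fst x + of_int (snd x) * fst y, snd x * snd y)"
proof (unfold split_paired_all, simp only: fst_conv snd_conv)
  fix a b c d :: 'a and l m n q :: int
  assume A: "intfracrel (a, l) (b, m)" and B: "intfracrel (c, n) (d, q)"
  from A obtain j where j: "j \<noteq> 0" "of_int j * (of_int m * a) = of_int j * (of_int l * b)"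
    by (auto simp: intfracrel_def)
  from B obtain k where k: "k \<noteq> 0" "of_int k * (of_int q * c) = of_int k * (of_int n * d)"
    by (auto simp: intfracrel_def)
  have "of_int (j * k) * (of_int (m * q) * (of_int n * a + of_int l * c))
      = of_int (k * q * n) * (of_int j * (of_int m * a))
        + of_int (j * m * l) * (of_int k * (of_int q * c))"
    by (simp add: algebra_simps)
  also have "\<dots> = of_int (j * k) * (of_int (l * n) * (of_int q * b + of_int m * d))"
    unfolding j(2) k(2) by (simp add: algebra_simps)
  finally show "intfracrel (of_int n * a + of_int l * c, l * n) (of_int q * b + of_int m * d, m * q)"
    using A B j(1) k(1) by (auto simp: intfracrel_def intro!: exI[of _ "j * k"])
qed

lift_definition uminus_rat_ext :: "'a rat_ext \<Rightarrow> 'a rat_ext"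
  is "\<lambda>x. (- fst x, snd x)"
  by (auto simp: intfracrel_def)

definition minus_rat_ext :: "'a rat_ext \<Rightarrow> 'a rat_ext \<Rightarrow> 'a rat_ext" where
  "minus_rat_ext x y = x + - y"

lift_definition times_rat_ext :: "'a rat_ext \<Rightarrow> 'a rat_ext \<Rightarrow> 'a rat_ext"
  is "\<lambda>x y. (fst x * fst y, snd x * snd y)"
proof (unfold split_paired_all, simp only: fst_conv snd_conv)
  fix a b c d :: 'a and l m n q :: int
  assume A: "intfracrel (a, l) (b, m)" and B: "intfracrel (c, n) (d, q)"
  from A obtain j where j: "j \<noteq> 0" "of_int j * (of_int m * a) = of_int j * (of_int l * b)"
    by (auto simp: intfracrel_def)
  from B obtain k where k: "k \<noteq> 0" "of_int k * (of_int q * c) = of_int k * (of_int n * d)"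
    by (auto simp: intfracrel_def)
  have "of_int (j * k) * (of_int (m * q) * (a * c))
      = (of_int j * (of_int m * a)) * (of_int k * (of_int q * c))"
    by (simp add: mult_ac)
  also have "\<dots> = of_int (j * k) * (of_int (l * n) * (b * d))"
    unfolding j(2) k(2) by (simp add: mult_ac)
  finally show "intfracrel (a * c, l * n) (b * d, m * q)"
    using A B j(1) k(1) by (auto simp: intfracrel_def intro!: exI[of _ "j * k"])
qed

lemma zero_ifrac: "(0 :: 'a rat_ext) = ifrac 0 1"
  by transfer (auto intro!: intfracrelI simp: algebra_simps)

lemma one_ifrac: "(1 :: 'a rat_ext) = ifrac 1 1"
  by transfer (auto intro!: intfracrelI simp: algebra_simps)

lemma add_ifrac:
  "m \<noteq> 0 \<Longrightarrow> n \<noteq> 0 \<Longrightarrow> ifrac r m + ifrac s n = ifrac (of_int n * r + of_int m * s) (m * n)"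
  for r s :: 'a
  by transfer (auto intro!: intfracrelI simp: algebra_simps)

lemma uminus_ifrac: "- ifrac r n = ifrac (- r) n" for r :: 'a
  by transfer (auto intro!: intfracrelI simp: algebra_simps)

lemma mult_ifrac: "m \<noteq> 0 \<Longrightarrow> n \<noteq> 0 \<Longrightarrow> ifrac r m * ifrac s n = ifrac (r * s) (m * n)"
  for r s :: 'a
  by transfer (auto intro!: intfracrelI simp: algebra_simps)

instance
proof
  fix a b c :: "'a rat_ext"
  show "a * b * c = a * (b * c)"
    by (cases a, cases b, cases c) (simp add: mult_ifrac mult_ac)
  show "a * b = b * a"
    by (cases a, cases b) (simp add: mult_ifrac mult_ac)
  show "a + b + c = a + (b + c)"
    by (cases a, cases b, cases c) (simp add: add_ifrac algebra_simps)
  show "a + b = b + a"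
    by (cases a, cases b) (simp add: add_ifrac algebra_simps)
  show "0 + a = a"
    by (cases a) (simp add: zero_ifrac add_ifrac)
  show "- a + a = 0"
    by (cases a) (auto simp: zero_ifrac add_ifrac uminus_ifrac intro!: ifrac_eqI)
  show "a - b = a + - b"
    by (rule minus_rat_ext_def)
  show "(a + b) * c = a * c + b * c"
    by (cases a, cases b, cases c)
      (auto simp: add_ifrac mult_ifrac algebra_simps intro!: ifrac_eqI)
qed

end

text \<open>
  Rings of characteristic zero in the sense that the canonical map \<open>R \<rightarrow> R \<otimes> \<rat>\<close>, sending \<open>r\<close> to the
  class of the fraction \<open>r/1\<close>, is injective. This is stronger than \<^class>\<open>ring_char_0\<close>.
\<close>

class char_zero_ring = comm_ring_1 +
  assumes inj_class_of_fraction: "inj (\<lambda>r. {x. intfracrel (r, 1) x})"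

lemma inj_ifrac: "inj (\<lambda>r::'a::char_zero_ring. ifrac r 1)"
proof (rule injI)
  fix r s :: 'a
  assume "ifrac r 1 = ifrac s 1"
  then have *: "intfracrel (r, 1) (s, 1)"
    by transfer simp
  have "{x. intfracrel (r, 1) x} = {x. intfracrel (s, 1) x}"
    using * part_equivp_intfracrel[where 'a='a]
    by (metis part_equivp_def)
  then show "r = s"
    using inj_class_of_fraction by (auto dest: injD)
qed

lemma char_zero_ring_torsion_free:
  fixes r :: "'a::char_zero_ring"
  assumes "of_int n * r = 0" "n \<noteq> 0"
  shows "r = 0"
proof -
  have "ifrac r 1 = ifrac 0 1"
    by (subst ifrac_eq_iff) (use assms in auto)
  then show ?thesis
    using inj_ifrac by (auto dest: injD)
qed

instance rat_ext :: (char_zero_ring) comm_ring_1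
proof
  fix a :: "'a rat_ext"
  show "1 * a = a"
    by (cases a) (simp add: one_ifrac mult_ifrac)
  show "(0 :: 'a rat_ext) \<noteq> 1"
    unfolding zero_ifrac one_ifrac using inj_ifrac[where 'a='a] by (auto dest: injD)
qed

instance int :: char_zero_ring
proof
  show "inj (\<lambda>r::int. {x. intfracrel (r, 1) x})"
  proof (rule injI)
    fix r s :: int
    assume "{x. intfracrel (r, 1) x} = {x. intfracrel (s, 1) x}"
    moreover have "intfracrel (r, 1) (r, 1)"
      by (rule intfracrelI) auto
    ultimately have "intfracrel (s, 1) (r, 1)"
      by auto
    then show "r = s"
      by (auto simp: intfracrel_def)
  qed
qed

text \<open>\<open>R \<otimes> \<int>\<^bsub>(p)\<^esub>\<close>, viewed inside \<open>R \<otimes> \<rat>\<close>\<close>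

definition p_integral :: "nat \<Rightarrow> 'a::char_zero_ring rat_ext set" where
  "p_integral p = {ifrac r n | r n. \<not> int p dvd n}"


section \<open>Formal group laws\<close>

definition is_comp_inverse :: "'a::comm_ring_1 fps \<Rightarrow> 'a fps \<Rightarrow> bool" where
  "is_comp_inverse f g \<longleftrightarrow> fps_nth g 0 = 0 \<and> fps_compose f g = fps_X \<and> fps_compose g f = fps_X"

text \<open>The library's \<^const>\<open>fps_inv\<close> and the associativity of composition require fields and domains.\<close>

definition comp_inverse :: "'a::comm_ring_1 fps \<Rightarrow> 'a fps" where
  "comp_inverse f = (THE g. is_comp_inverse f g)"

lemma fps_compose_nth_le:
  fixes a c :: "'a::comm_ring_1 fps"
  assumes "fps_nth c 0 = 0" "n \<le> N"
  shows "fps_nth (fps_compose a c) n = (\<Sum>i\<le>N. fps_nth a i * fps_nth (c ^ i) n)"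
  unfolding fps_compose_nth using assms
  by (intro sum.mono_neutral_left) (auto simp: startsby_zero_power_prefix)

lemma fps_compose_mult_comm_ring:
  fixes a b c :: "'a::comm_ring_1 fps"
  assumes c: "fps_nth c 0 = 0"
  shows "fps_compose (a * b) c = fps_compose a c * fps_compose b c"
proof (rule fps_ext)
  fix n
  have "fps_nth (fps_compose a c * fps_compose b c) n =
      (\<Sum>l\<le>n. (\<Sum>i\<le>n. fps_nth a i * fps_nth (c ^ i) l) * (\<Sum>j\<le>n. fps_nth b j * fps_nth (c ^ j) (n - l)))"
    unfolding fps_mult_nth atLeast0AtMost
    by (intro sum.cong arg_cong2[of _ _ _ _ "(*)"] fps_compose_nth_le c) auto
  also have "\<dots> = (\<Sum>l\<le>n. \<Sum>i\<le>n. \<Sum>j\<le>n. fps_nth a i * fps_nth b j * (fps_nth (c ^ i) l * fps_nth (c ^ j) (n - l)))"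
    by (simp add: sum_product mult_ac)
  also have "\<dots> = (\<Sum>i\<le>n. \<Sum>j\<le>n. \<Sum>l\<le>n. fps_nth a i * fps_nth b j * (fps_nth (c ^ i) l * fps_nth (c ^ j) (n - l)))"
    by (subst sum.swap, rule sum.cong[OF refl], subst sum.swap, rule refl)
  also have "\<dots> = (\<Sum>i\<le>n. \<Sum>j\<le>n. fps_nth a i * fps_nth b j * fps_nth (c ^ (i + j)) n)"
    by (simp add: power_add fps_mult_nth atLeast0AtMost sum_distrib_left)
  also have "\<dots> = (\<Sum>(i, j)\<in>{..n} \<times> {..n}. fps_nth a i * fps_nth b j * fps_nth (c ^ (i + j)) n)"
    by (simp add: sum.cartesian_product)
  also have "\<dots> = (\<Sum>(i, j)\<in>{(i, j). i + j \<le> n}. fps_nth a i * fps_nth b j * fps_nth (c ^ (i + j)) n)"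
  proof (intro sum.mono_neutral_right ballI)
    fix x
    assume "x \<in> {..n} \<times> {..n} - {(i, j). i + j \<le> n}"
    then have "fps_nth (c ^ (fst x + snd x)) n = 0"
      using startsby_zero_power_prefix[OF c, of "fst x + snd x"] by auto
    then show "(case x of (i, j) \<Rightarrow> fps_nth a i * fps_nth b j * fps_nth (c ^ (i + j)) n) = 0"
      by (simp add: case_prod_beta)
  qed auto
  also have "\<dots> = (\<Sum>k\<le>n. \<Sum>i\<le>k. fps_nth a i * fps_nth b (k - i) * fps_nth (c ^ (i + (k - i))) n)"
    by (rule sum.triangle_reindex_eq)
  also have "\<dots> = fps_nth (fps_compose (a * b) c) n"
    by (simp add: fps_compose_nth fps_mult_nth atLeast0AtMost sum_distrib_right)
  finally show "fps_nth (fps_compose (a * b) c) n = fps_nth (fps_compose a c * fps_compose b c) n"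
    by simp
qed

lemma fps_compose_power_comm_ring:
  fixes a c :: "'a::comm_ring_1 fps"
  assumes "fps_nth c 0 = 0"
  shows "fps_compose (a ^ n) c = fps_compose a c ^ n"
  by (induction n) (simp_all add: fps_compose_mult_comm_ring assms)

lemma fps_compose_assoc_comm_ring:
  fixes a b c :: "'a::comm_ring_1 fps"
  assumes b: "fps_nth b 0 = 0" and c: "fps_nth c 0 = 0"
  shows "fps_compose a (fps_compose b c) = fps_compose (fps_compose a b) c"
proof (rule fps_ext)
  fix n
  have "fps_nth (fps_compose a (fps_compose b c)) n =
      (\<Sum>i\<le>n. fps_nth a i * fps_nth (fps_compose (b ^ i) c) n)"
    by (simp add: fps_compose_nth atLeast0AtMost fps_compose_power_comm_ring c)
  also have "\<dots> = (\<Sum>i\<le>n. \<Sum>j\<le>n. fps_nth a i * fps_nth (b ^ i) j * fps_nth (c ^ j) n)"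
    by (simp add: fps_compose_nth atLeast0AtMost sum_distrib_left mult_ac)
  also have "\<dots> = (\<Sum>j\<le>n. (\<Sum>i\<le>n. fps_nth a i * fps_nth (b ^ i) j) * fps_nth (c ^ j) n)"
    by (subst sum.swap) (simp add: sum_distrib_right)
  also have "\<dots> = fps_nth (fps_compose (fps_compose a b) c) n"
    unfolding fps_compose_nth[of "fps_compose a b"] atLeast0AtMost
    by (intro sum.cong refl arg_cong2[of _ _ _ _ "(*)"] fps_compose_nth_le[symmetric] b) auto
  finally show "fps_nth (fps_compose a (fps_compose b c)) n = fps_nth (fps_compose (fps_compose a b) c) n" .
qed

fun left_inverse_coeff :: "'a::comm_ring_1 fps \<Rightarrow> nat \<Rightarrow> 'a" where
  "left_inverse_coeff f n =
     fps_nth fps_X n - (\<Sum>i<n. left_inverse_coeff f i * fps_nth (f ^ i) n)"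

declare left_inverse_coeff.simps [simp del]

lemma ex_left_inverse:
  fixes f :: "'a::comm_ring_1 fps"
  assumes f: "fps_nth f 0 = 0" "fps_nth f 1 = 1"
  obtains g where "fps_nth g 0 = 0" "fps_nth g 1 = 1" "fps_compose g f = fps_X"
proof
  let ?g = "Abs_fps (left_inverse_coeff f)"
  show "fps_nth ?g 0 = 0" "fps_nth ?g 1 = 1"
    by (simp_all add: left_inverse_coeff.simps[of f 0] left_inverse_coeff.simps[of f "Suc 0"])
  show "fps_compose ?g f = fps_X"
  proof (rule fps_ext)
    fix n
    have "fps_nth (fps_compose ?g f) n =
        (\<Sum>i<n. left_inverse_coeff f i * fps_nth (f ^ i) n) + left_inverse_coeff f n"
      using startsby_zero_power_nth_same[OF f(1), of n] f(2)
      unfolding fps_compose_nth atLeast0AtMost lessThan_Suc_atMost[symmetric] sum.lessThan_Suc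
      by simp
    then show "fps_nth (fps_compose ?g f) n = fps_nth fps_X n"
      by (subst (asm) left_inverse_coeff.simps[of f n]) simp
  qed
qed

lemma is_comp_inverse_comp_inverse:
  fixes f :: "'a::comm_ring_1 fps"
  assumes f: "fps_nth f 0 = 0" "fps_nth f 1 = 1"
  shows "is_comp_inverse f (comp_inverse f)"
proof -
  have X: "fps_compose fps_X a = a" if "fps_nth a 0 = 0" for a :: "'a fps"
    using that by (simp add: fps_X_fps_compose fps_eq_iff)
  obtain g where g: "fps_nth g 0 = 0" "fps_nth g 1 = 1" "fps_compose g f = fps_X"
    using ex_left_inverse[OF f] .
  obtain h where h: "fps_nth h 0 = 0" "fps_compose h g = fps_X"
    using ex_left_inverse[OF g(1,2)] by metis
  have "h = f"
    using fps_compose_assoc_comm_ring[OF g(1) f(1), of h] by (simp add: g h X f)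
  with g h have "is_comp_inverse f g"
    by (simp add: is_comp_inverse_def)
  moreover have "g' = g" if "is_comp_inverse f g'" for g'
    using fps_compose_assoc_comm_ring[OF f(1) g(1), of g'] that \<open>h = f\<close> h g
    by (simp add: is_comp_inverse_def X)
  ultimately show ?thesis
    unfolding comp_inverse_def by (rule theI)
qed

text \<open>
  Series in two variables \<open>x\<close>, \<open>y\<close> are series in \<open>y\<close> whose coefficients are series in \<open>x\<close>.
  For \<open>G\<close> without constant term, the coefficient of \<open>x\<^sup>iy\<^sup>j\<close> in \<open>G\<^sup>k\<close> vanishes for \<open>k > i + j\<close>, so the
  following is \<open>h(G(x,y))\<close>. Note that \<^const>\<open>fps_compose\<close> on iterated series cannot be used: it cuts
  off at \<open>k > j\<close>, and \<open>G\<close> need not be without constant term as a series in \<open>y\<close>.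
\<close>

definition fps_subst2 :: "'a::comm_ring_1 fps \<Rightarrow> 'a fps fps \<Rightarrow> 'a fps fps" where
  "fps_subst2 h G =
     Abs_fps (\<lambda>j. Abs_fps (\<lambda>i. \<Sum>k\<le>i + j. fps_nth h k * fps_nth (fps_nth (G ^ k) j) i))"

definition fps_in_x :: "'a::comm_ring_1 fps \<Rightarrow> 'a fps fps" where
  "fps_in_x f = fps_const f"

definition fps_in_y :: "'a::comm_ring_1 fps \<Rightarrow> 'a fps fps" where
  "fps_in_y f = Abs_fps (\<lambda>j. fps_const (fps_nth f j))"

definition formal_group_law :: "'a::comm_ring_1 fps \<Rightarrow> 'a fps fps" where
  "formal_group_law f = fps_subst2 (comp_inverse f) (fps_in_x f + fps_in_y f)"

definition log_series :: "(nat \<Rightarrow> 'a::char_zero_ring) \<Rightarrow> 'a rat_ext fps" where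
  "log_series b = Abs_fps (\<lambda>n. if n = 0 then 0 else ifrac (b (n - 1)) (int n))"


section \<open>Frobenius endomorphisms and \<open>p\<close>-sequences\<close>

definition frobenius_endo :: "nat \<Rightarrow> ('a::comm_ring_1 \<Rightarrow> 'a) \<Rightarrow> bool" where
  "frobenius_endo p \<sigma> \<longleftrightarrow>
     (\<forall>r s. \<sigma> (r + s) = \<sigma> r + \<sigma> s) \<and> (\<forall>r s. \<sigma> (r * s) = \<sigma> r * \<sigma> s) \<and> \<sigma> 1 = 1 \<and>
     (\<forall>r. of_nat p dvd \<sigma> r - r ^ p)"

definition plen :: "nat \<Rightarrow> nat \<Rightarrow> nat" where
  "plen p n = (LEAST s. 1 \<le> s \<and> n < p ^ s)"

definition pconcat :: "nat \<Rightarrow> nat \<Rightarrow> nat \<Rightarrow> nat" where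
  "pconcat p n m = n + m * p ^ plen p n"

text \<open>\<open>n\<^sub>1 * (n\<^sub>2 * (\<dots> * n\<^sub>k))\<close>; the last factor is combined with the empty expansion \<open>0\<close>, as \<open>n * 0 = n\<close>.\<close>

definition pconcat_list :: "nat \<Rightarrow> nat list \<Rightarrow> nat" where
  "pconcat_list p ns = foldr (pconcat p) ns 0"

definition p_decomps :: "nat \<Rightarrow> nat \<Rightarrow> nat list set" where
  "p_decomps p n = {ns. ns \<noteq> [] \<and> (\<forall>m \<in> set (tl ns). 0 < m) \<and> pconcat_list p ns = n}"

lemma
  assumes "1 < p"
  shows one_le_plen: "1 \<le> plen p n" and less_power_plen: "n < p ^ plen p n"
proof -
  have "n < p ^ Suc n"
    using power_gt_expt[of p "Suc n"] assms by simp
  then have "1 \<le> Suc n \<and> n < p ^ Suc n"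
    by simp
  then have "1 \<le> plen p n \<and> n < p ^ plen p n"
    unfolding plen_def by (rule LeastI)
  then show "1 \<le> plen p n" "n < p ^ plen p n"
    by auto
qed

lemma pconcat_list_bounds:
  assumes p: "1 < p" and pos: "\<forall>m \<in> set ns. 0 < m"
  shows "set ns \<subseteq> {..pconcat_list p ns} \<and> length ns \<le> pconcat_list p ns"
  using pos
proof (induction ns)
  case (Cons n ns)
  have "pconcat_list p ns * 1 \<le> pconcat_list p ns * p ^ plen p n"
    using p by (intro mult_le_mono2) simp
  then have "pconcat_list p ns + n \<le> pconcat_list p (n # ns)"
    by (simp add: pconcat_list_def pconcat_def)
  moreover have "set ns \<subseteq> {..pconcat_list p ns} \<and> length ns \<le> pconcat_list p ns" "0 < n"
    using Cons by auto
  ultimately show ?case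
    by (auto intro: order_trans)
qed (simp add: pconcat_list_def)

lemma finite_p_decomps:
  assumes p: "1 < p"
  shows "finite (p_decomps p n)"
proof (rule finite_subset)
  show "p_decomps p n \<subseteq> {ns. set ns \<subseteq> {..n} \<and> length ns \<le> Suc n}"
  proof
    fix ns
    assume "ns \<in> p_decomps p n"
    then obtain m ms where ns: "ns = m # ms" "\<forall>m \<in> set ms. 0 < m" "pconcat_list p ns = n"
      by (cases ns) (auto simp: p_decomps_def)
    have "pconcat_list p ms * 1 \<le> pconcat_list p ms * p ^ plen p m"
      using p by (intro mult_le_mono2) simp
    then have "m + pconcat_list p ms \<le> pconcat_list p ns"
      by (simp add: ns(1) pconcat_list_def pconcat_def)
    then have "m \<le> n" "pconcat_list p ms \<le> n"
      using ns(3) by auto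
    with pconcat_list_bounds[OF p ns(2)] ns(1) show "ns \<in> {ns. set ns \<subseteq> {..n} \<and> length ns \<le> Suc n}"
      by auto
  qed
qed (simp add: finite_lists_length_le)

definition p_sequence :: "nat \<Rightarrow> ('a::comm_ring_1 \<Rightarrow> 'a) \<Rightarrow> (nat \<Rightarrow> 'a) \<Rightarrow> nat \<Rightarrow> 'a" where
  "p_sequence p \<sigma> b n =
     (\<Sum>ns \<in> p_decomps p n. (- 1) ^ (length ns - 1) *
        (\<Prod>i<length ns. (\<sigma> ^^ (\<Sum>j<i. plen p (ns ! j))) (b (ns ! i))))"

end

theory Submission
  imports Defs "HOL-Algebra.Exponent"
begin

text \<open>
  Writing \<open>f = \<Sum> b\<^bsub>n-1\<^esub> x\<^sup>n / n\<close>, the identity \<open>b\<^sub>n = \<Sum> c\<^sub>m \<sigma>\<^bsup>\<ell>(m)\<^esup>(b\<^sub>l)\<close>, summed over \<open>n = m * l\<close>,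
  shows that the divisibility condition on \<open>c\<close> makes \<open>f(x) - \<Sum>\<^sub>s (v\<^sub>s/p) (\<sigma>\<^sup>s f)(x\<^bsup>p^s\<^esup>)\<close> integral,
  where \<open>v\<^sub>s = c\<^bsub>p^s-1\<^esub> / p\<^bsup>s-1\<^esup>\<close>. Integrality of the group law then follows from Hazewinkel's
  functional equation lemma. It is applied to series in a single variable \<open>t\<close> over \<open>(R \<otimes> \<rat>)[[u]]\<close>,
  with \<open>x = t\<close> and \<open>y = ut\<close>, where the Frobenius acts by \<open>u \<mapsto> u\<^sup>p\<close>.

  Conversely, suppose the law of \<open>f\<close> is integral and the condition holds for \<open>c\<^sub>i\<close> with \<open>i < N - 1\<close>.
  Replacing the remaining \<open>c\<^sub>i\<close> by \<open>0\<close> gives another integral law, and the two differ by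
  \<open>(c\<^bsub>N-1\<^esub>/N) (x\<^sup>N + y\<^sup>N - (x + y)\<^sup>N)\<close> up to higher terms. For \<open>N = mp\<^sup>k\<close> with \<open>m > 1\<close>, the
  binomial coefficient of \<open>N\<close> over \<open>p\<^sup>k\<close> is \<open>m\<close> times a number prime to \<open>p\<close>, so \<open>p\<^sup>k\<close> divides \<open>c\<^bsub>N-1\<^esub>\<close>.
\<close>

unbundle fps_syntax

section \<open>Rings with a Frobenius lift\<close>

text \<open>The inner binomial coefficients are multiples of p, so the cofactor of p needs no
  division in the ring.\<close>

lemma add_power_prime:
  fixes a b :: "'a::comm_ring_1"
  assumes p: "prime p"
  shows "(a + b) ^ p = a ^ p + b ^ p +
    of_nat p * (\<Sum>k\<in>{0<..<p}. of_nat ((p choose k) div p) * a ^ k * b ^ (p - k))"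
proof -
  have "{..p} = insert 0 (insert p {0<..<p})" "p > 0"
    using prime_gt_0_nat[OF p] by auto
  then have "(a + b) ^ p = a ^ p + b ^ p + (\<Sum>k\<in>{0<..<p}. of_nat (p choose k) * a ^ k * b ^ (p - k))"
    by (simp add: binomial_ring)
  also have "(\<Sum>k\<in>{0<..<p}. of_nat (p choose k) * a ^ k * b ^ (p - k))
      = (\<Sum>k\<in>{0<..<p}. of_nat p * (of_nat ((p choose k) div p) * a ^ k * b ^ (p - k)))"
  proof (rule sum.cong[OF refl])
    fix k
    assume "k \<in> {0<..<p}"
    then have "p choose k = p * ((p choose k) div p)"
      using dvd_choose_prime[of k p] p by (simp add: prime_gt_0_nat)
    then have "(of_nat (p choose k) :: 'a) = of_nat p * of_nat ((p choose k) div p)"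
      by (metis of_nat_mult)
    then show "of_nat (p choose k) * a ^ k * b ^ (p - k)
        = of_nat p * (of_nat ((p choose k) div p) * a ^ k * b ^ (p - k))"
      by (simp add: mult.assoc)
  qed
  finally show ?thesis
    by (simp add: sum_distrib_left)
qed

text \<open>\<open>A\<close> is the ring of integral elements inside a ring where \<open>q\<close>
  is 1/p, so a congruence x = y mod p^k reads \<open>q ^ k * (x - y) \<in> A\<close>. It is used for
  fractions and, repeatedly, for power series over them.\<close>

locale frobenius_lift =
  fixes A :: "'a::comm_ring_1 set" and \<sigma> :: "'a \<Rightarrow> 'a" and p :: nat and q :: 'a
  assumes prime_p: "prime p"
    and p_mult_q: "of_nat p * q = 1"
    and one_mem: "1 \<in> A"
    and diff_mem: "a \<in> A \<Longrightarrow> b \<in> A \<Longrightarrow> a - b \<in> A"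
    and mult_mem: "a \<in> A \<Longrightarrow> b \<in> A \<Longrightarrow> a * b \<in> A"
    and hom_add: "\<sigma> (a + b) = \<sigma> a + \<sigma> b"
    and hom_mult: "\<sigma> (a * b) = \<sigma> a * \<sigma> b"
    and hom_one: "\<sigma> 1 = 1"
    and hom_mem: "a \<in> A \<Longrightarrow> \<sigma> a \<in> A"
    and frobenius: "a \<in> A \<Longrightarrow> q * (\<sigma> a - a ^ p) \<in> A"
begin

lemma zero_mem: "0 \<in> A"
  using diff_mem[OF one_mem one_mem] by simp

lemma uminus_mem: "a \<in> A \<Longrightarrow> - a \<in> A"
  using diff_mem[OF zero_mem, of a] by simp

lemma add_mem: "a \<in> A \<Longrightarrow> b \<in> A \<Longrightarrow> a + b \<in> A"
  using diff_mem[OF _ uminus_mem, of a b] by simp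

lemma sum_mem: "(\<And>i. i \<in> I \<Longrightarrow> f i \<in> A) \<Longrightarrow> sum f I \<in> A"
  by (induction I rule: infinite_finite_induct) (auto intro: zero_mem add_mem)

lemma power_mem: "a \<in> A \<Longrightarrow> a ^ n \<in> A"
  by (induction n) (auto intro: one_mem mult_mem)

lemma of_nat_mem: "of_nat n \<in> A"
  by (induction n) (auto intro: zero_mem one_mem add_mem)

lemma hom_zero: "\<sigma> 0 = 0"
  using hom_add[of 0 0] by simp

lemma hom_of_nat: "\<sigma> (of_nat n) = of_nat n"
  by (induction n) (simp_all add: hom_zero hom_add hom_one)

lemma hom_power: "\<sigma> (a ^ n) = \<sigma> a ^ n"
  by (induction n) (simp_all add: hom_one hom_mult)

lemma hom_sum: "\<sigma> (sum f I) = (\<Sum>i\<in>I. \<sigma> (f i))"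
  by (induction I rule: infinite_finite_induct) (simp_all add: hom_zero hom_add)

lemma q_power_mult: "q ^ n * of_nat p ^ n = 1"
  using p_mult_q by (metis mult.commute power_mult_distrib power_one)

lemma
  shows funpow_add: "(\<sigma> ^^ s) (a + b) = (\<sigma> ^^ s) a + (\<sigma> ^^ s) b"
    and funpow_hom_mult: "(\<sigma> ^^ s) (a * b) = (\<sigma> ^^ s) a * (\<sigma> ^^ s) b"
    and funpow_zero: "(\<sigma> ^^ s) 0 = 0"
    and funpow_one: "(\<sigma> ^^ s) 1 = 1"
    and funpow_of_nat: "(\<sigma> ^^ s) (of_nat n) = of_nat n"
    and funpow_power: "(\<sigma> ^^ s) (a ^ n) = (\<sigma> ^^ s) a ^ n"
    and funpow_mem: "a \<in> A \<Longrightarrow> (\<sigma> ^^ s) a \<in> A"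
  by (induction s)
    (simp_all add: hom_add hom_mult hom_zero hom_one hom_of_nat hom_power hom_mem)

lemma funpow_sum: "(\<sigma> ^^ s) (sum f I) = (\<Sum>i\<in>I. (\<sigma> ^^ s) (f i))"
  by (induction I rule: infinite_finite_induct) (auto simp: funpow_zero funpow_add)

lemma cong_power:
  assumes XY: "X \<in> A" "Y \<in> A" "q * (X - Y) \<in> A"
  shows "q * (X ^ n - Y ^ n) \<in> A"
proof -
  have "q * (X ^ n - Y ^ n) = q * (X - Y) * (\<Sum>i<n. Y ^ (n - Suc i) * X ^ i)"
    by (simp add: power_diff_sumr2 mult.assoc)
  then show ?thesis
    using XY by (auto intro!: mult_mem sum_mem power_mem)
qed

text \<open>X^p - Y^p is X - Y times the sum of the Y^(p-1-i) X^i. Since X = Y mod p, this cofactor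
  is congruent to p Y^(p-1), hence to 0, mod p.\<close>

lemma cong_power_p:
  assumes XY: "X \<in> A" "Y \<in> A" "q ^ Suc k * (X - Y) \<in> A"
  shows "q ^ Suc (Suc k) * (X ^ p - Y ^ p) \<in> A"
proof -
  have "of_nat p ^ k * (q ^ Suc k * (X - Y)) = q ^ k * of_nat p ^ k * (q * (X - Y))"
    by (simp add: mult_ac)
  then have XY': "q * (X - Y) \<in> A"
    using XY mult_mem[OF power_mem[OF of_nat_mem, of p k] XY(3)] by (simp add: q_power_mult)
  have "q * (\<Sum>i<p. Y ^ (p - Suc i) * X ^ i)
      = (\<Sum>i<p. Y ^ (p - Suc i) * (q * (X ^ i - Y ^ i)) + q * (Y ^ (p - Suc i) * Y ^ i))"
    by (simp add: sum_distrib_left algebra_simps)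
  also have "\<dots> = (\<Sum>i<p. Y ^ (p - Suc i) * (q * (X ^ i - Y ^ i))) + (\<Sum>i<p. q * Y ^ (p - 1))"
    unfolding sum.distrib
    by (intro arg_cong2[of _ _ _ _ "(+)"] sum.cong refl) (auto simp: power_add[symmetric])
  also have "(\<Sum>i<p. q * Y ^ (p - 1)) = of_nat p * q * Y ^ (p - 1)"
    by (simp add: mult.assoc)
  finally have "q * (\<Sum>i<p. Y ^ (p - Suc i) * X ^ i)
      = (\<Sum>i<p. Y ^ (p - Suc i) * (q * (X ^ i - Y ^ i))) + Y ^ (p - 1)"
    by (simp add: p_mult_q)
  also have "\<dots> \<in> A"
    using XY XY' by (intro add_mem sum_mem mult_mem[OF power_mem cong_power] power_mem)
  finally have "q * (\<Sum>i<p. Y ^ (p - Suc i) * X ^ i) \<in> A" .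
  moreover have "q ^ Suc (Suc k) * (X ^ p - Y ^ p)
      = (q ^ Suc k * (X - Y)) * (q * (\<Sum>i<p. Y ^ (p - Suc i) * X ^ i))"
    by (simp add: power_diff_sumr2 mult_ac)
  ultimately show ?thesis
    using XY(3) by (simp only: mult_mem)
qed

lemma cong_power_p_power:
  assumes XY: "X \<in> A" "Y \<in> A" "q * (X - Y) \<in> A"
  shows "q ^ Suc k * (X ^ (p ^ k * m) - Y ^ (p ^ k * m)) \<in> A"
proof (induction k)
  case 0
  show ?case
    using cong_power[OF XY] by simp
next
  case (Suc k)
  have eq: "Z ^ (p ^ Suc k * m) = (Z ^ (p ^ k * m)) ^ p" for Z :: 'a
    by (simp add: power_mult[symmetric] mult_ac)
  show ?case
    unfolding eq by (intro cong_power_p power_mem XY Suc)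
qed

lemma frobenius_funpow: "a \<in> A \<Longrightarrow> q * ((\<sigma> ^^ s) a - a ^ (p ^ s)) \<in> A"
proof (induction s)
  case (Suc s)
  have "q * ((\<sigma> ^^ Suc s) a - a ^ (p ^ Suc s))
      = q * (\<sigma> ((\<sigma> ^^ s) a) - (\<sigma> ^^ s) a ^ p) + q * ((\<sigma> ^^ s) a ^ p - (a ^ (p ^ s)) ^ p)"
    by (simp add: power_mult[symmetric] mult.commute[of p] right_diff_distrib)
  then show ?case
    using Suc by (auto intro!: add_mem frobenius cong_power funpow_mem power_mem)
qed (simp add: zero_mem)

end

section \<open>Power series over a ring with a Frobenius lift\<close>

definition coeffs_in :: "'a::zero set \<Rightarrow> 'a fps set" where
  "coeffs_in A = {P. \<forall>n. P $ n \<in> A}"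

text \<open>The extension of \<sigma> to series that sends the variable t to t^p.\<close>

definition frob_fps :: "nat \<Rightarrow> ('a::comm_ring_1 \<Rightarrow> 'a) \<Rightarrow> 'a fps \<Rightarrow> 'a fps" where
  "frob_fps p \<sigma> P = Abs_fps (\<lambda>n. if p dvd n then \<sigma> (P $ (n div p)) else 0)"

lemma frob_fps_nth_funpow:
  assumes "\<sigma> 0 = 0" "p > 0"
  shows "(frob_fps p \<sigma> ^^ s) P $ n = (if p ^ s dvd n then (\<sigma> ^^ s) (P $ (n div p ^ s)) else 0)"
proof (induction s arbitrary: n)
  case (Suc s)
  show ?case
  proof (cases "p dvd n")
    case True
    then obtain m where n: "n = p * m" ..
    have "(\<sigma> ^^ s) 0 = 0"
      using assms(1) by (induction s) simp_all
    then show ?thesis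
      using Suc assms by (simp add: n frob_fps_def)
  next
    case False
    then show ?thesis
      by (auto simp: frob_fps_def dest: dvd_mult_left)
  qed
qed simp

lemma fps_compose_X_power_nth:
  fixes P :: "'a::comm_ring_1 fps"
  assumes "p > 0"
  shows "fps_compose P (fps_X ^ p) $ n = (if p dvd n then P $ (n div p) else 0)"
proof -
  have "fps_compose P (fps_X ^ p) $ n = (\<Sum>i\<in>{0..n}. if n = p * i then P $ i else 0)"
    by (auto simp: fps_compose_nth power_mult[symmetric] intro!: sum.cong)
  also have "\<dots> = (if p dvd n then P $ (n div p) else 0)"
  proof (cases "p dvd n")
    case True
    then obtain m where m: "n = p * m" ..
    then have "m \<le> n" "n = p * i \<longleftrightarrow> i = m" "n div p = m" for i
      using assms by auto
    then show ?thesis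
      using True by (simp only: sum.delta finite_atLeastAtMost) simp
  qed (auto intro!: sum.neutral)
  finally show ?thesis .
qed

context frobenius_lift
begin

lemma frob_fps_eq_compose: "frob_fps p \<sigma> P = fps_compose (Abs_fps (\<lambda>n. \<sigma> (P $ n))) (fps_X ^ p)"
  using prime_gt_0_nat[OF prime_p]
  by (intro fps_ext) (simp add: fps_compose_X_power_nth frob_fps_def)

lemma frob_fps_add: "frob_fps p \<sigma> (P + Q) = frob_fps p \<sigma> P + frob_fps p \<sigma> Q"
  by (intro fps_ext) (simp add: frob_fps_def hom_add)

lemma frob_fps_mult: "frob_fps p \<sigma> (P * Q) = frob_fps p \<sigma> P * frob_fps p \<sigma> Q"
proof -
  have "Abs_fps (\<lambda>n. \<sigma> ((P * Q) $ n)) = Abs_fps (\<lambda>n. \<sigma> (P $ n)) * Abs_fps (\<lambda>n. \<sigma> (Q $ n))"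
    by (intro fps_ext) (simp add: fps_mult_nth hom_sum hom_mult)
  moreover have "fps_nth (fps_X ^ p) 0 = (0 :: 'a)"
    using prime_gt_0_nat[OF prime_p] by simp
  ultimately show ?thesis
    by (simp add: frob_fps_eq_compose fps_compose_mult_comm_ring)
qed

lemma coeffs_in_mult: "P \<in> coeffs_in A \<Longrightarrow> Q \<in> coeffs_in A \<Longrightarrow> P * Q \<in> coeffs_in A"
  by (auto simp: coeffs_in_def fps_mult_nth intro!: sum_mem mult_mem)

lemma coeffs_in_power: "P \<in> coeffs_in A \<Longrightarrow> P ^ n \<in> coeffs_in A"
proof (induction n)
  case 0
  then show ?case
    by (simp add: coeffs_in_def one_mem zero_mem)
qed (simp add: coeffs_in_mult)

lemma coeffs_in_sum: "(\<And>i. i \<in> I \<Longrightarrow> f i \<in> coeffs_in A) \<Longrightarrow> sum f I \<in> coeffs_in A"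
  by (simp add: coeffs_in_def fps_sum_nth sum_mem)

lemma coeffs_in_const: "a \<in> A \<Longrightarrow> fps_const a \<in> coeffs_in A"
  by (simp add: coeffs_in_def zero_mem)

lemma coeffs_in_of_nat: "of_nat n \<in> coeffs_in A"
  using coeffs_in_const[OF of_nat_mem] by (simp add: fps_of_nat)

lemma coeffs_in_X: "fps_X \<in> coeffs_in A"
  by (simp add: coeffs_in_def fps_X_def one_mem zero_mem)

text \<open>Splits off one coefficient at a time, \<open>P = a + t \<cdot> Q\<close>, since the binomial congruence is only
  available for finite sums.\<close>

lemma frob_fps_cong:
  assumes "P \<in> coeffs_in A"
  shows "q * (frob_fps p \<sigma> P - P ^ p) $ n \<in> A"
  using assms
proof (induction n arbitrary: P rule: less_induct)
  case (less n)
  have p: "p > 0"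
    using prime_gt_0_nat[OF prime_p] .
  define a where "a = fps_const (P $ 0)"
  define Q where "Q = Abs_fps (\<lambda>n. P $ Suc n)"
  have P: "P = a + fps_X * Q"
    by (rule fps_ext) (auto simp: a_def Q_def)
  have mem: "Q \<in> coeffs_in A"
    using less.prems by (auto simp: Q_def coeffs_in_def)
  define E where "E = (\<Sum>k\<in>{0<..<p}. of_nat ((p choose k) div p) * a ^ k * (fps_X * Q) ^ (p - k))"
  have E: "E \<in> coeffs_in A"
    unfolding E_def
    by (intro coeffs_in_sum coeffs_in_mult coeffs_in_power coeffs_in_of_nat coeffs_in_X mem)
      (use less.prems in \<open>auto simp: a_def coeffs_in_def zero_mem\<close>)
  have "P ^ p = a ^ p + (fps_X * Q) ^ p + of_nat p * E"
    unfolding P E_def by (rule add_power_prime[OF prime_p])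
  moreover have "frob_fps p \<sigma> P = fps_const (\<sigma> (P $ 0)) + fps_X ^ p * frob_fps p \<sigma> Q"
  proof -
    have "frob_fps p \<sigma> P = frob_fps p \<sigma> a + frob_fps p \<sigma> fps_X * frob_fps p \<sigma> Q"
      by (subst P) (simp add: frob_fps_add frob_fps_mult)
    moreover have "frob_fps p \<sigma> a = fps_const (\<sigma> (P $ 0))"
      using p by (intro fps_ext) (auto simp: frob_fps_def a_def hom_zero elim!: dvdE)
    moreover have "frob_fps p \<sigma> fps_X = fps_X ^ p"
      using p by (intro fps_ext) (auto simp: frob_fps_def hom_zero hom_one elim!: dvdE)
    ultimately show ?thesis
      by simp
  qed
  \<comment> \<open>Divided by p, the first summand is integral by the congruence in
    \<open>A\<close>, the second by induction at degree n - p, the third by its factor p.\<close>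
  ultimately have "frob_fps p \<sigma> P - P ^ p
      = fps_const (\<sigma> (P $ 0) - (P $ 0) ^ p) + fps_X ^ p * (frob_fps p \<sigma> Q - Q ^ p) - fps_const (of_nat p) * E"
    by (simp add: a_def fps_const_power power_mult_distrib algebra_simps fps_of_nat flip: fps_const_sub)
  then have "(frob_fps p \<sigma> P - P ^ p) $ n
      = (if n = 0 then \<sigma> (P $ 0) - (P $ 0) ^ p else 0)
        + (if n < p then 0 else (frob_fps p \<sigma> Q - Q ^ p) $ (n - p)) - of_nat p * E $ n"
    by (simp only: fps_sub_nth fps_add_nth fps_X_power_mult_nth fps_mult_left_const_nth fps_nth_fps_const)
  then have "q * (frob_fps p \<sigma> P - P ^ p) $ n
      = (if n = 0 then q * (\<sigma> (P $ 0) - (P $ 0) ^ p) else 0)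
        + (if n < p then 0 else q * (frob_fps p \<sigma> Q - Q ^ p) $ (n - p)) - of_nat p * q * E $ n"
    by (simp only: ring_distribs mult_ac if_distrib[of "\<lambda>x. q * x"] mult_zero_right mult_zero_left)
  moreover have "q * (\<sigma> (P $ 0) - (P $ 0) ^ p) \<in> A"
    using less.prems by (intro frobenius) (simp add: coeffs_in_def)
  moreover have "q * (frob_fps p \<sigma> Q - Q ^ p) $ (n - p) \<in> A" if "\<not> n < p"
    using that p by (intro less.IH mem) auto
  ultimately show ?case
    using E by (auto simp: p_mult_q coeffs_in_def simp del: fps_sub_nth
        intro!: add_mem diff_mem uminus_mem zero_mem)
qed

text \<open>The hypotheses pass to series, so the results below also apply when the coefficients are
  themselves series in u.\<close>

lemma frobenius_lift_fps: "frobenius_lift (coeffs_in A) (frob_fps p \<sigma>) p (fps_const q)"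
proof
  show "prime p"
    by (rule prime_p)
  have "of_nat p * fps_const q = fps_const (of_nat p * q)"
    by (simp flip: fps_of_nat)
  then show "of_nat p * fps_const q = 1"
    by (simp add: p_mult_q)
  show "1 \<in> coeffs_in A"
    by (simp add: coeffs_in_def one_mem zero_mem)
  show "P - Q \<in> coeffs_in A" if "P \<in> coeffs_in A" "Q \<in> coeffs_in A" for P Q
    using that by (simp add: coeffs_in_def diff_mem)
  show "frob_fps p \<sigma> 1 = 1"
    using prime_gt_0_nat[OF prime_p]
    by (intro fps_ext) (auto simp: frob_fps_def hom_zero hom_one elim!: dvdE)
  show "frob_fps p \<sigma> P \<in> coeffs_in A" if "P \<in> coeffs_in A" for P
    using that by (simp add: coeffs_in_def frob_fps_def hom_mem zero_mem)
  show "fps_const q * (frob_fps p \<sigma> P - P ^ p) \<in> coeffs_in A" if "P \<in> coeffs_in A" for P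
    using frob_fps_cong[OF that] by (simp add: coeffs_in_def)
qed (rule coeffs_in_mult frob_fps_add frob_fps_mult; assumption?)+

end

section \<open>The functional equation lemma\<close>

lemma exists_power_times_coprime:
  fixes n p :: nat
  assumes "prime p" "n > 0"
  obtains k m where "n = p ^ k * m" "\<not> p dvd m"
  using multiplicity_decompose'[of n p] assms by (metis not_prime_unit not_gr_zero)

lemma power_nth_cong:
  fixes P Q :: "'a::comm_ring_1 fps"
  assumes "\<And>m. m \<le> n \<Longrightarrow> P $ m = Q $ m"
  shows "(P ^ i) $ n = (Q ^ i) $ n"
  using assms
proof (induction i arbitrary: n)
  case (Suc i)
  then show ?case
    by (auto simp: fps_mult_nth intro!: sum.cong)
qed simp

text \<open>Isolates the linear term, the only one in which \<open>F $ n\<close> enters by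
  \<open>power_nth_cong_less\<close>.\<close>

lemma fps_compose_nth_split:
  fixes f F :: "'a::comm_ring_1 fps"
  assumes f: "f $ 0 = 0" "f $ 1 = 1" and F: "F $ 0 = 0" and n: "n > 0"
  shows "fps_compose f F $ n = F $ n + (\<Sum>i\<in>{2..n}. f $ i * F ^ i $ n)"
proof -
  have "{..n} = insert 0 (insert 1 {2..n})"
    using n by auto
  then show ?thesis
    using f by (simp add: fps_compose_nth_le[OF F order_refl])
qed

text \<open>In P * P^j with j > 0, both n-th coefficients are multiplied by the constant term of the
  other factor, which is 0.\<close>

lemma power_nth_cong_less:
  fixes P Q :: "'a::comm_ring_1 fps"
  assumes "\<And>m. m < n \<Longrightarrow> P $ m = Q $ m" "P $ 0 = 0" "Q $ 0 = 0" "i \<ge> 2"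
  shows "(P ^ i) $ n = (Q ^ i) $ n"
proof -
  obtain j where j: "i = Suc j" "j > 0"
    using assms(4) by (cases i) auto
  have "(P ^ i) $ n = (\<Sum>k=0..n. P $ k * (P ^ j) $ (n - k))"
    by (simp add: j fps_mult_nth)
  also have "\<dots> = (\<Sum>k=0..n. Q $ k * (Q ^ j) $ (n - k))"
  proof (rule sum.cong[OF refl])
    fix k
    assume k: "k \<in> {0..n}"
    show "P $ k * (P ^ j) $ (n - k) = Q $ k * (Q ^ j) $ (n - k)"
    proof (cases "k = 0 \<or> k = n")
      case True
      then show ?thesis
        using assms(2,3) j(2) by (auto simp: startsby_zero_power)
    next
      case False
      then show ?thesis
        using k assms(1) by (intro arg_cong2[of _ _ _ _ "(*)"] power_nth_cong) auto
    qed
  qed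
  also have "\<dots> = (Q ^ i) $ n"
    by (simp add: j fps_mult_nth)
  finally show ?thesis .
qed

context frobenius_lift
begin

text \<open>The coefficients of \<open>f - \<Sum>\<^sub>s (v\<^sub>s/p) (\<sigma>\<^sup>s f)(t\<^bsup>p^s\<^esup>)\<close> for \<open>q = 1/p\<close>; terms with \<open>s > n\<close> cannot
  contribute to the \<open>n\<close>-th one.\<close>

definition fe_defect :: "(nat \<Rightarrow> 'a) \<Rightarrow> 'a fps \<Rightarrow> nat \<Rightarrow> 'a" where
  "fe_defect v f n = f $ n - (\<Sum>s\<in>{1..n}. v s * (q * (frob_fps p \<sigma> ^^ s) f $ n))"

lemma frob_nth:
  "(frob_fps p \<sigma> ^^ s) P $ n = (if p ^ s dvd n then (\<sigma> ^^ s) (P $ (n div p ^ s)) else 0)"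
  using prime_gt_0_nat[OF prime_p] by (simp add: frob_fps_nth_funpow hom_zero)

lemma frob_nth_eq_0:
  assumes "f $ 0 = 0" "i < s"
  shows "(frob_fps p \<sigma> ^^ s) f $ i = 0"
proof (cases "i = 0")
  case False
  have "i < p ^ s"
    using assms(2) power_gt_expt[of p s] prime_gt_1_nat[OF prime_p] by simp
  then show ?thesis
    using False by (auto simp: frob_nth dest: dvd_imp_le)
qed (simp add: frob_nth assms funpow_zero)

text \<open>A common bound n for s, reached by adding vanishing terms, allows the sums over i and s
  to be interchanged later.\<close>

lemma fe_defect_eq:
  assumes "f $ 0 = 0" "i \<le> n"
  shows "f $ i = fe_defect v f i + (\<Sum>s\<in>{1..n}. v s * (q * (frob_fps p \<sigma> ^^ s) f $ i))"
proof -
  have "(\<Sum>s\<in>{1..n}. v s * (q * (frob_fps p \<sigma> ^^ s) f $ i)) =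
      (\<Sum>s\<in>{1..i}. v s * (q * (frob_fps p \<sigma> ^^ s) f $ i))"
    using assms by (intro sum.mono_neutral_right) (auto simp: frob_nth_eq_0)
  then show ?thesis
    by (simp add: fe_defect_def)
qed

text \<open>By induction the s-th term of the functional equation has denominator at most p *
  p^(k-s), which divides p^k because s \<ge> 1; the defect itself is integral.\<close>

lemma fe_denominator:
  assumes v: "\<And>s. v s \<in> A" and f: "f $ 0 = 0" "\<And>n. fe_defect v f n \<in> A"
  shows "\<not> p dvd m \<Longrightarrow> of_nat p ^ k * f $ (p ^ k * m) \<in> A"
proof (induction k rule: less_induct)
  case (less k)
  let ?n = "p ^ k * m"
  have "of_nat p ^ k * (v s * (q * (frob_fps p \<sigma> ^^ s) f $ ?n)) \<in> A" if s: "s \<in> {1..?n}" for s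
  proof (cases "p ^ s dvd ?n")
    case True
    have "s \<le> k"
    proof (rule ccontr)
      assume "\<not> s \<le> k"
      then have "p ^ Suc k dvd p ^ k * m"
        using True by (meson dvd_trans le_imp_power_dvd not_less_eq_eq)
      then show False
        using less.prems prime_gt_0_nat[OF prime_p] by simp
    qed
    then have n: "?n div p ^ s = p ^ (k - s) * m"
      using prime_gt_0_nat[OF prime_p] by (metis (no_types, lifting) dvd_div_mult le_imp_power_dvd
          not_gr_zero power_diff power_not_zero)
    obtain l where l: "s = Suc l"
      using s by (cases s) auto
    have "of_nat p ^ k = (of_nat p ^ l * of_nat p ^ (k - s) * of_nat p :: 'a)"
      using \<open>s \<le> k\<close> by (simp add: l flip: power_add power_Suc2)
    then have "of_nat p ^ k * (v s * (q * (frob_fps p \<sigma> ^^ s) f $ ?n))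
        = v s * (of_nat p ^ l * ((of_nat p * q) * (of_nat p ^ (k - s) * (\<sigma> ^^ s) (f $ (p ^ (k - s) * m)))))"
      using True n by (simp add: frob_nth mult_ac)
    also have "\<dots> = v s * (of_nat p ^ l * ((\<sigma> ^^ s) (of_nat p ^ (k - s) * f $ (p ^ (k - s) * m))))"
      by (simp add: p_mult_q funpow_hom_mult funpow_power funpow_of_nat)
    also have "\<dots> \<in> A"
      using \<open>s \<le> k\<close> l less.prems by (intro mult_mem v power_mem of_nat_mem funpow_mem less.IH) auto
    finally show ?thesis .
  qed (simp add: frob_nth zero_mem)
  moreover have "of_nat p ^ k * f $ ?n = of_nat p ^ k * fe_defect v f ?n
      + (\<Sum>s\<in>{1..?n}. of_nat p ^ k * (v s * (q * (frob_fps p \<sigma> ^^ s) f $ ?n)))"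
    by (subst fe_defect_eq[OF f(1) order_refl, of _ v]) (simp add: distrib_left sum_distrib_left)
  ultimately show ?case
    by (simp only:) (intro add_mem sum_mem mult_mem[OF power_mem[OF of_nat_mem] f(2)])
qed

lemma frob_funpow_eq_compose:
  "(frob_fps p \<sigma> ^^ s) f = fps_compose (Abs_fps (\<lambda>n. (\<sigma> ^^ s) (f $ n))) (fps_X ^ (p ^ s))"
  using prime_gt_0_nat[OF prime_p]
  by (intro fps_ext) (simp add: frob_nth fps_compose_X_power_nth)

text \<open>With \<open>frob_funpow_compose\<close>, both orders of Frobenius and composition with P
  become one series \<sigma>^s f, evaluated at P^(p^s) and at the Frobenius image of P.\<close>

lemma frob_funpow_compose_left:
  assumes P: "P $ 0 = 0"
  shows "fps_compose ((frob_fps p \<sigma> ^^ s) f) P = fps_compose (Abs_fps (\<lambda>n. (\<sigma> ^^ s) (f $ n))) (P ^ (p ^ s))"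
proof -
  have "fps_compose fps_X P = P"
    using P by (simp add: fps_X_fps_compose fps_eq_iff)
  then show ?thesis
    using prime_gt_0_nat[OF prime_p] P
    by (simp add: frob_funpow_eq_compose fps_compose_power_comm_ring flip: fps_compose_assoc_comm_ring)
qed

lemma frob_funpow_compose:
  assumes P: "P $ 0 = 0"
  shows "(frob_fps p \<sigma> ^^ s) (fps_compose f P) =
    fps_compose (Abs_fps (\<lambda>n. (\<sigma> ^^ s) (f $ n))) ((frob_fps p \<sigma> ^^ s) P)"
proof (rule fps_ext)
  fix n
  interpret F: frobenius_lift "coeffs_in A" "frob_fps p \<sigma>" p "fps_const q"
    by (rule frobenius_lift_fps)
  have 0: "(frob_fps p \<sigma> ^^ s) P $ 0 = 0"
    using P by (simp add: frob_nth funpow_zero)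
  have "fps_compose (Abs_fps (\<lambda>n. (\<sigma> ^^ s) (f $ n))) ((frob_fps p \<sigma> ^^ s) P) $ n
      = (\<Sum>i\<le>n. (\<sigma> ^^ s) (f $ i) * (frob_fps p \<sigma> ^^ s) (P ^ i) $ n)"
    by (subst fps_compose_nth_le[OF 0 order_refl]) (simp add: F.funpow_power)
  also have "\<dots> = (frob_fps p \<sigma> ^^ s) (fps_compose f P) $ n"
    using fps_compose_nth_le[OF P, of "n div p ^ s" n f]
    by (simp add: frob_nth funpow_sum funpow_hom_mult)
  finally show "(frob_fps p \<sigma> ^^ s) (fps_compose f P) $ n =
      fps_compose (Abs_fps (\<lambda>n. (\<sigma> ^^ s) (f $ n))) ((frob_fps p \<sigma> ^^ s) P) $ n"
    by simp
qed

text \<open>Composing with an integral series \<open>P\<close> commutes with the Frobenius up to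
  \<open>f(P\<^bsup>p\<^esup>) - f(\<sigma>P(t\<^sup>p))\<close>, where the congruence modulo \<open>p\<close> between the arguments improves
  by a factor \<open>p\<^sup>k\<close> under the exponent \<open>p\<^sup>km\<close> and so absorbs the denominator of the coefficient.\<close>

lemma fe_defect_compose:
  assumes v: "\<And>s. v s \<in> A" and f: "f $ 0 = 0" "\<And>n. fe_defect v f n \<in> A"
    and P: "P \<in> coeffs_in A" "P $ 0 = 0"
  shows "fe_defect v (fps_compose f P) n \<in> A"
proof -
  interpret F: frobenius_lift "coeffs_in A" "frob_fps p \<sigma>" p "fps_const q"
    by (rule frobenius_lift_fps)
  let ?K = "fps_compose f P" and ?\<phi> = "frob_fps p \<sigma>"
  let ?\<Delta> = "\<lambda>s m. ((P ^ (p ^ s)) ^ m - (?\<phi> ^^ s) P ^ m) $ n"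
  have P0: "(P ^ (p ^ s)) $ 0 = 0" "(?\<phi> ^^ s) P $ 0 = 0" for s
    using P(2) prime_gt_0_nat[OF prime_p] by (simp_all add: frob_nth funpow_zero startsby_zero_power)
  have \<Delta>: "fps_compose ((?\<phi> ^^ s) f) P $ n - (?\<phi> ^^ s) ?K $ n = (\<Sum>m\<le>n. (\<sigma> ^^ s) (f $ m) * ?\<Delta> s m)" for s
    unfolding frob_funpow_compose_left[OF P(2)] frob_funpow_compose[OF P(2)]
      fps_compose_nth_le[OF P0(1) order_refl] fps_compose_nth_le[OF P0(2) order_refl]
    by (simp add: right_diff_distrib sum_subtractf)
  have "?K $ n = (\<Sum>i\<le>n. f $ i * P ^ i $ n)"
    by (rule fps_compose_nth_le[OF P(2) order_refl])
  also have "\<dots> = (\<Sum>i\<le>n. (fe_defect v f i + (\<Sum>s\<in>{1..n}. v s * (q * (?\<phi> ^^ s) f $ i))) * P ^ i $ n)"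
    using fe_defect_eq[OF f(1)] by (intro sum.cong) auto
  also have "\<dots> = (\<Sum>i\<le>n. fe_defect v f i * P ^ i $ n)
      + (\<Sum>i\<le>n. \<Sum>s\<in>{1..n}. v s * (q * ((?\<phi> ^^ s) f $ i * P ^ i $ n)))"
    by (simp add: distrib_right sum.distrib sum_distrib_right mult.assoc)
  also have "(\<Sum>i\<le>n. \<Sum>s\<in>{1..n}. v s * (q * ((?\<phi> ^^ s) f $ i * P ^ i $ n)))
      = (\<Sum>s\<in>{1..n}. v s * (q * fps_compose ((?\<phi> ^^ s) f) P $ n))"
    by (subst sum.swap) (simp add: fps_compose_nth_le[OF P(2) order_refl] sum_distrib_left)
  finally have "fe_defect v ?K n = (\<Sum>i\<le>n. fe_defect v f i * P ^ i $ n)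
      + (\<Sum>s\<in>{1..n}. v s * (q * (fps_compose ((?\<phi> ^^ s) f) P $ n - (?\<phi> ^^ s) ?K $ n)))"
    by (simp add: fe_defect_def right_diff_distrib sum_subtractf)
  then have eq: "fe_defect v ?K n = (\<Sum>i\<le>n. fe_defect v f i * P ^ i $ n)
      + (\<Sum>s\<in>{1..n}. v s * (\<Sum>m\<le>n. q * ((\<sigma> ^^ s) (f $ m) * ?\<Delta> s m)))"
    by (simp only: \<Delta> sum_distrib_left)
  have mem: "q * ((\<sigma> ^^ s) (f $ m) * ?\<Delta> s m) \<in> A" for s m
  proof (cases "m = 0")
    case False
    then obtain k m' where m: "m = p ^ k * m'" "\<not> p dvd m'"
      using exists_power_times_coprime[OF prime_p, of m] by auto
    have "fps_const q * (P ^ (p ^ s) - (?\<phi> ^^ s) P) \<in> coeffs_in A"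
      using F.uminus_mem[OF F.frobenius_funpow[OF P(1), of s]] by (simp add: right_diff_distrib)
    then have "fps_const q ^ Suc k * ((P ^ (p ^ s)) ^ m - (?\<phi> ^^ s) P ^ m) \<in> coeffs_in A"
      unfolding m(1) by (intro F.cong_power_p_power F.power_mem F.funpow_mem P(1))
    then have \<Delta>_mem: "q ^ Suc k * ?\<Delta> s m \<in> A"
      unfolding fps_const_power coeffs_in_def by (metis (mono_tags) fps_mult_left_const_nth mem_Collect_eq)
    \<comment> \<open>The factor p^k goes to \<open>f $ m\<close>, clearing its denominator, and q^k
      to the difference of m-th powers, which is divisible by p^(k+1).\<close>
    have "q * ((\<sigma> ^^ s) (f $ m) * ?\<Delta> s m)
        = (q ^ k * of_nat p ^ k) * (q * ((\<sigma> ^^ s) (f $ m) * ?\<Delta> s m))"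
      by (simp only: q_power_mult mult_1_left)
    also have "\<dots> = (\<sigma> ^^ s) (of_nat p ^ k * f $ m) * (q ^ Suc k * ?\<Delta> s m)"
      by (simp add: funpow_hom_mult funpow_power funpow_of_nat mult_ac del: fps_sub_nth)
    finally show ?thesis
      using fe_denominator[OF v f m(2), of k] \<Delta>_mem by (simp add: m(1) mult_mem funpow_mem)
  qed (simp add: f(1) funpow_zero zero_mem)
  have "P ^ i $ n \<in> A" for i
    using coeffs_in_power[OF P(1)] by (simp add: coeffs_in_def)
  then show ?thesis
    unfolding eq by (intro add_mem sum_mem mult_mem[OF f(2)] mult_mem[OF v] mem)
qed

text \<open>Induction on the degree: with P the truncation of F below n, the series H and f(P) agree
  below n, so their integral defects at n differ exactly by \<open>F $ n\<close>.\<close>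

theorem functional_equation_lemma:
  assumes v: "\<And>s. v s \<in> A"
    and f: "f $ 0 = 0" "f $ 1 = 1" "\<And>n. fe_defect v f n \<in> A"
    and H: "\<And>n. fe_defect v H n \<in> A"
    and F: "F $ 0 = 0" "fps_compose f F = H"
  shows "F \<in> coeffs_in A"
proof -
  have "F $ n \<in> A" for n
  proof (induction n rule: less_induct)
    case (less n)
    define P where "P = Abs_fps (\<lambda>m. if m < n then F $ m else 0)"
    have P: "P \<in> coeffs_in A" "P $ 0 = 0"
      using less F by (auto simp: P_def coeffs_in_def zero_mem)
    let ?K = "fps_compose f P"
    show ?case
    proof (cases "n = 0")
      case False
      have "?K $ m = H $ m" if "m < n" for m
        unfolding F(2)[symmetric] using that
        by (auto simp: fps_compose_nth P_def intro!: sum.cong arg_cong2[of _ _ _ _ "(*)"] power_nth_cong)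
      \<comment> \<open>For s \<ge> 1 a nonzero Frobenius term at n reads the coefficient at n / p^s
        < n, where both series agree.\<close>
      then have "(frob_fps p \<sigma> ^^ s) ?K $ n = (frob_fps p \<sigma> ^^ s) H $ n" if "s \<in> {1..n}" for s
        using that False one_less_power[OF prime_gt_1_nat[OF prime_p], of s] by (simp add: frob_nth)
      then have "fe_defect v H n - fe_defect v ?K n = H $ n - ?K $ n"
        by (simp add: fe_defect_def)
      also have "\<dots> = F $ n"
      proof -
        have "(\<Sum>i\<in>{2..n}. f $ i * F ^ i $ n) = (\<Sum>i\<in>{2..n}. f $ i * P ^ i $ n)"
          by (intro sum.cong refl arg_cong2[of _ _ _ _ "(*)"] power_nth_cong_less) (auto simp: P_def F)
        moreover have "P $ n = 0"
          by (simp add: P_def)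
        ultimately show ?thesis
          using fps_compose_nth_split[OF f(1,2) F(1), of n] fps_compose_nth_split[OF f(1,2) P(2), of n]
            False F(2) by simp
      qed
      finally show ?thesis
        using diff_mem[OF H[of n] fe_defect_compose[OF v f(1,3) P, of n]] by simp
    qed (simp add: F zero_mem)
  qed
  then show ?thesis
    by (simp add: coeffs_in_def)
qed

end

section \<open>Formal group laws in one variable of total degree\<close>

lemma fps_in_y_mult: "fps_in_y (f * g) = fps_in_y f * fps_in_y (g :: 'a::comm_ring_1 fps)"
  by (intro fps_ext) (simp add: fps_in_y_def fps_mult_nth fps_sum_nth)

lemma fps_in_y_power: "fps_in_y (f ^ n) = fps_in_y (f :: 'a::comm_ring_1 fps) ^ n"
proof (induction n)
  case 0
  show ?case
    by (intro fps_ext) (simp add: fps_in_y_def)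
qed (simp add: fps_in_y_mult)

lemma fps_in_y_compose:
  "fps_in_y (fps_compose f g) = fps_compose (fps_in_y f) (fps_in_y (g :: 'a::comm_ring_1 fps))"
proof (rule fps_ext)
  fix n
  have "fps_compose (fps_in_y f) (fps_in_y g) $ n = (\<Sum>i=0..n. fps_const (f $ i) * fps_in_y (g ^ i) $ n)"
    by (simp add: fps_compose_nth fps_in_y_power) (simp add: fps_in_y_def)
  then show "fps_in_y (fps_compose f g) $ n = fps_compose (fps_in_y f) (fps_in_y g) $ n"
    by (intro fps_ext) (simp add: fps_in_y_def fps_compose_nth fps_sum_nth)
qed

text \<open>\<open>G(t, ut)\<close> as a series in \<open>t\<close> whose coefficients are series in \<open>u\<close>. Unlike in
  \<open>G(x, y)\<close>, the outer variable now measures the total degree, so that substitution into a series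
  in one variable becomes \<^const>\<open>fps_compose\<close>.\<close>

definition dehomogenize :: "'a::comm_ring_1 fps fps \<Rightarrow> 'a fps fps" where
  "dehomogenize G = Abs_fps (\<lambda>d. Abs_fps (\<lambda>j. if j \<le> d then G $ j $ (d - j) else 0))"

lemma dehomogenize_nth: "dehomogenize G $ d $ j = (if j \<le> d then G $ j $ (d - j) else 0)"
  by (simp add: dehomogenize_def)

lemma dehomogenize_mult: "dehomogenize (G * H) = dehomogenize G * dehomogenize H"
proof (intro fps_ext)
  fix d j
  let ?g = "\<lambda>k l. G $ k $ l * H $ (j - k) $ (d - j - l)"
  have "(dehomogenize G * dehomogenize H) $ d $ j
      = (\<Sum>e\<le>d. \<Sum>k\<le>j. dehomogenize G $ e $ k * dehomogenize H $ (d - e) $ (j - k))"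
    by (simp add: fps_mult_nth fps_sum_nth atLeast0AtMost)
  also have "\<dots> = (\<Sum>k\<le>j. \<Sum>e\<le>d. dehomogenize G $ e $ k * dehomogenize H $ (d - e) $ (j - k))"
    by (rule sum.swap)
  also have "\<dots> = (if j \<le> d then \<Sum>k\<le>j. \<Sum>l\<le>d - j. ?g k l else 0)"
  proof (cases "j \<le> d")
    case True
    have "(\<Sum>e\<le>d. dehomogenize G $ e $ k * dehomogenize H $ (d - e) $ (j - k)) = (\<Sum>l\<le>d - j. ?g k l)"
      if k: "k \<le> j" for k
    proof -
      \<comment> \<open>The first factor vanishes for e < k and the second for e > k + (d - j); e =
        k + l reindexes the rest.\<close>
      have "(\<Sum>e\<le>d. dehomogenize G $ e $ k * dehomogenize H $ (d - e) $ (j - k))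
          = (\<Sum>e\<in>{k..k + (d - j)}. dehomogenize G $ e $ k * dehomogenize H $ (d - e) $ (j - k))"
        using k True by (intro sum.mono_neutral_right) (auto simp: dehomogenize_nth)
      also have "\<dots> = (\<Sum>l\<le>d - j. ?g k l)"
        using k True
        by (intro sum.reindex_bij_witness[of _ "\<lambda>l. k + l" "\<lambda>e. e - k"])
          (auto simp: dehomogenize_nth intro!: arg_cong2[of _ _ _ _ "(*)"] arg_cong2[of _ _ _ _ fps_nth])
      finally show ?thesis .
    qed
    then show ?thesis
      using True by simp
  next
    case False
    then show ?thesis
      by (auto simp: dehomogenize_nth intro!: sum.neutral)
  qed
  also have "\<dots> = dehomogenize (G * H) $ d $ j"
    by (simp add: dehomogenize_nth fps_mult_nth fps_sum_nth atLeast0AtMost)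
  finally show "dehomogenize (G * H) $ d $ j = (dehomogenize G * dehomogenize H) $ d $ j"
    by simp
qed

lemma dehomogenize_power: "dehomogenize (G ^ n) = dehomogenize G ^ n"
proof (induction n)
  case 0
  show ?case
    by (intro fps_ext) (simp add: dehomogenize_nth)
qed (simp add: dehomogenize_mult)

text \<open>The cutoff k \<le> i + j in \<open>fps_subst2\<close> is the cutoff at total degree in
  \<open>fps_compose\<close>.\<close>

lemma dehomogenize_subst2: "dehomogenize (fps_subst2 h G) = fps_compose (fps_in_y h) (dehomogenize G)"
proof (intro fps_ext)
  fix d j
  have "fps_compose (fps_in_y h) (dehomogenize G) $ d $ j = (\<Sum>i\<le>d. h $ i * dehomogenize (G ^ i) $ d $ j)"
    by (simp add: fps_compose_nth dehomogenize_power fps_in_y_def fps_sum_nth atLeast0AtMost)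
  then show "dehomogenize (fps_subst2 h G) $ d $ j = fps_compose (fps_in_y h) (dehomogenize G) $ d $ j"
    by (simp add: dehomogenize_nth fps_subst2_def)
qed

text \<open>This is f(t) + f(ut).\<close>

definition additive_series :: "'a::comm_ring_1 fps \<Rightarrow> 'a fps fps" where
  "additive_series f = Abs_fps (\<lambda>n. fps_const (f $ n) * (1 + fps_X ^ n))"

lemma dehomogenize_in_x_plus_in_y:
  assumes "f $ 0 = 0"
  shows "dehomogenize (fps_in_x f + fps_in_y f) = additive_series f"
  by (intro fps_ext) (use assms in \<open>auto simp: dehomogenize_nth fps_in_x_def fps_in_y_def additive_series_def\<close>)

definition total_fgl :: "'a::comm_ring_1 fps \<Rightarrow> 'a fps fps" where
  "total_fgl f = dehomogenize (formal_group_law f)"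

text \<open>Replaces the definition of F(t, ut) by an equation free of the compositional
  inverse.\<close>

lemma total_fgl:
  fixes f :: "'a::comm_ring_1 fps"
  assumes f: "f $ 0 = 0" "f $ 1 = 1"
  shows "total_fgl f $ 0 = 0" "fps_compose (fps_in_y f) (total_fgl f) = additive_series f"
proof -
  let ?h = "comp_inverse f"
  have h: "?h $ 0 = 0" "fps_compose f ?h = fps_X"
    using is_comp_inverse_comp_inverse[OF f] by (simp_all add: is_comp_inverse_def)
  have eq: "total_fgl f = fps_compose (fps_in_y ?h) (additive_series f)"
    using f(1) by (simp add: total_fgl_def formal_group_law_def dehomogenize_subst2 dehomogenize_in_x_plus_in_y)
  have 0: "additive_series f $ 0 = 0" "fps_in_y ?h $ 0 = 0"
    using f(1) h(1) by (simp_all add: additive_series_def fps_in_y_def)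
  show "total_fgl f $ 0 = 0"
    using 0 by (simp add: eq fps_compose_nth)
  have X: "fps_in_y fps_X = (fps_X :: 'a fps fps)"
    by (intro fps_ext) (simp add: fps_in_y_def fps_X_def)
  have "fps_compose (fps_in_y f) (total_fgl f) = fps_compose (fps_in_y (fps_compose f ?h)) (additive_series f)"
    by (simp add: eq fps_compose_assoc_comm_ring 0 fps_in_y_compose)
  also have "\<dots> = additive_series f"
    unfolding h(2) X using 0(1) by (simp add: fps_X_fps_compose fps_eq_iff)
  finally show "fps_compose (fps_in_y f) (total_fgl f) = additive_series f" .
qed

lemma total_fgl_in_iff:
  assumes "0 \<in> A"
  shows "total_fgl f \<in> coeffs_in (coeffs_in A) \<longleftrightarrow> (\<forall>i j. formal_group_law f $ j $ i \<in> A)"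
proof
  assume *: "total_fgl f \<in> coeffs_in (coeffs_in A)"
  show "\<forall>i j. formal_group_law f $ j $ i \<in> A"
  proof (intro allI)
    fix i j
    have "total_fgl f $ (i + j) $ j \<in> A"
      using * by (simp add: coeffs_in_def)
    then show "formal_group_law f $ j $ i \<in> A"
      by (simp add: total_fgl_def dehomogenize_nth)
  qed
qed (use assms in \<open>simp add: total_fgl_def dehomogenize_nth coeffs_in_def\<close>)

text \<open>In degree m the equation f(F) = f(t) + f(ut) determines \<open>total_fgl f $ m\<close>
  from coefficients of f up to m and lower coefficients of F.\<close>

lemma total_fgl_cong:
  fixes f g :: "'a::comm_ring_1 fps"
  assumes f: "f $ 0 = 0" "f $ 1 = 1" and g: "g $ 0 = 0" "g $ 1 = 1"
    and eq: "\<And>i. i < n \<Longrightarrow> f $ i = g $ i"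
  shows "m < n \<Longrightarrow> total_fgl f $ m = total_fgl g $ m"
proof (induction m rule: less_induct)
  case (less m)
  let ?F = "total_fgl f" and ?G = "total_fgl g"
  have y: "fps_in_y f $ 0 = 0" "fps_in_y f $ 1 = 1" "fps_in_y g $ 0 = 0" "fps_in_y g $ 1 = 1"
    using f g by (simp_all add: fps_in_y_def)
  show ?case
  proof (cases "m = 0")
    case False
    have "(\<Sum>i\<in>{2..m}. fps_in_y f $ i * ?F ^ i $ m) = (\<Sum>i\<in>{2..m}. fps_in_y g $ i * ?G ^ i $ m)"
    proof (intro sum.cong refl arg_cong2[of _ _ _ _ "(*)"] power_nth_cong_less)
      show "fps_in_y f $ i = fps_in_y g $ i" if "i \<in> {2..m}" for i
        using that eq less.prems by (simp add: fps_in_y_def)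
    qed (use less total_fgl(1) f g in auto)
    moreover have "additive_series f $ m = additive_series g $ m"
      using eq less.prems by (simp add: additive_series_def)
    ultimately show ?thesis
      using fps_compose_nth_split[OF y(1,2) total_fgl(1)[OF f], of m]
        fps_compose_nth_split[OF y(3,4) total_fgl(1)[OF g], of m] False
      by (simp add: total_fgl(2)[OF f] total_fgl(2)[OF g])
  qed (simp add: total_fgl(1)[OF f] total_fgl(1)[OF g])
qed

text \<open>Subtracting the equations in degree n leaves 1 + u^n from the right-hand sides and (1 +
  u)^n from the n-th power of F = (1 + u)t + ...; the terms with exponents from 2 to n - 1
  cancel.\<close>

lemma total_fgl_nth_diff:
  fixes f g :: "'a::comm_ring_1 fps"
  assumes f: "f $ 0 = 0" "f $ 1 = 1" and g: "g $ 0 = 0" "g $ 1 = 1"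
    and eq: "\<And>i. i < n \<Longrightarrow> f $ i = g $ i" and n: "n \<ge> 2"
  shows "total_fgl f $ n - total_fgl g $ n =
    fps_const (f $ n - g $ n) * (1 + fps_X ^ n - (1 + fps_X) ^ n)"
proof -
  let ?F = "total_fgl f" and ?G = "total_fgl g"
  have y: "fps_in_y f $ 0 = 0" "fps_in_y f $ 1 = 1" "fps_in_y g $ 0 = 0" "fps_in_y g $ 1 = 1"
    using f g by (simp_all add: fps_in_y_def)
  have pow: "?F ^ i $ n = ?G ^ i $ n" if "i \<ge> 2" for i
    using that total_fgl_cong[OF f g eq] total_fgl(1) f g by (intro power_nth_cong_less) auto
  have "?F $ 1 = 1 + fps_X"
    using fps_compose_nth_split[OF y(1,2) total_fgl(1)[OF f], of 1] f
    by (simp add: total_fgl(2)[OF f] additive_series_def)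
  then have pow_n: "?F ^ n $ n = (1 + fps_X) ^ n"
    using startsby_zero_power_nth_same[OF total_fgl(1)[OF f], of n] by simp
  have split: "{2..n} = insert n {2..<n}"
    using n by auto
  have "(\<Sum>i\<in>{2..n}. fps_in_y f $ i * ?F ^ i $ n) - (\<Sum>i\<in>{2..n}. fps_in_y g $ i * ?G ^ i $ n)
      = (\<Sum>i\<in>{2..n}. (fps_in_y f $ i - fps_in_y g $ i) * ?F ^ i $ n)"
    by (simp add: pow sum_subtractf left_diff_distrib)
  also have "\<dots> = fps_const (f $ n - g $ n) * (1 + fps_X) ^ n"
    using eq by (simp add: split pow_n fps_in_y_def)
  finally show ?thesis
    using fps_compose_nth_split[OF y(1,2) total_fgl(1)[OF f], of n]
      fps_compose_nth_split[OF y(3,4) total_fgl(1)[OF g], of n] n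
    by (simp add: total_fgl(2)[OF f] total_fgl(2)[OF g] additive_series_def algebra_simps
        flip: fps_const_sub)
qed

lemma fps_const_sum: "fps_const (sum f I) = (\<Sum>i\<in>I. fps_const (f i :: 'a::comm_ring_1))"
  by (induction I rule: infinite_finite_induct) (simp_all flip: fps_const_add)

context frobenius_lift
begin

lemma frob_fps_const: "(frob_fps p \<sigma> ^^ s) (fps_const a) = fps_const ((\<sigma> ^^ s) a)"
  using prime_gt_0_nat[OF prime_p]
  by (intro fps_ext) (auto simp: frob_nth funpow_zero elim!: dvdE)

lemma frob_fps_X_power: "(frob_fps p \<sigma> ^^ s) (fps_X ^ n) = fps_X ^ (p ^ s * n)"
  using prime_gt_0_nat[OF prime_p]
  by (intro fps_ext) (auto simp: frob_nth funpow_zero funpow_one elim!: dvdE)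

theorem total_fgl_integral:
  assumes v: "\<And>s. v s \<in> A" and f: "f $ 0 = 0" "f $ 1 = 1" "\<And>n. fe_defect v f n \<in> A"
  shows "total_fgl f \<in> coeffs_in (coeffs_in A)"
proof -
  interpret F: frobenius_lift "coeffs_in A" "frob_fps p \<sigma>" p "fps_const q"
    by (rule frobenius_lift_fps)
  let ?v = "\<lambda>s. fps_const (v s)"
  \<comment> \<open>Frobenius sends u^(n/p^s) to u^n, so the factor 1 + u^n comes out of every
    term.\<close>
  have H: "F.fe_defect ?v (additive_series f) n = fps_const (fe_defect v f n) * (1 + fps_X ^ n)" for n
  proof -
    have "(frob_fps p (frob_fps p \<sigma>) ^^ s) (additive_series f) $ n
        = fps_const ((frob_fps p \<sigma> ^^ s) f $ n) * (1 + fps_X ^ n)" for s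
      by (auto simp: F.frob_nth frob_nth additive_series_def F.funpow_hom_mult F.funpow_add
          F.funpow_one frob_fps_const frob_fps_X_power elim!: dvdE)
    then show ?thesis
      by (simp add: F.fe_defect_def fe_defect_def additive_series_def left_diff_distrib
          sum_distrib_right mult.assoc fps_const_sum flip: fps_const_sub fps_const_mult)
  qed
  have Y: "F.fe_defect ?v (fps_in_y f) n = fps_const (fe_defect v f n)" for n
  proof -
    have "(frob_fps p (frob_fps p \<sigma>) ^^ s) (fps_in_y f) $ n = fps_const ((frob_fps p \<sigma> ^^ s) f $ n)" for s
      by (auto simp: F.frob_nth frob_nth fps_in_y_def frob_fps_const)
    then show ?thesis
      by (simp add: F.fe_defect_def fe_defect_def fps_in_y_def fps_const_sum flip: fps_const_sub)
  qed
  show ?thesis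
  proof (rule F.functional_equation_lemma[of ?v "fps_in_y f" "additive_series f"])
    show "F.fe_defect ?v (additive_series f) n \<in> coeffs_in A" for n
      unfolding H by (intro coeffs_in_mult coeffs_in_const f(3) F.add_mem F.one_mem coeffs_in_power coeffs_in_X)
    show "F.fe_defect ?v (fps_in_y f) n \<in> coeffs_in A" for n
      unfolding Y by (intro coeffs_in_const f(3))
    show "fps_in_y f $ 0 = 0" "fps_in_y f $ 1 = 1"
      using f by (simp_all add: fps_in_y_def)
  qed (use total_fgl[OF f(1,2)] coeffs_in_const v in auto)
qed

end

section \<open>The Frobenius lift on \<open>R \<otimes> \<rat>\<close>\<close>

text \<open>A description by representatives, because for an arbitrary map \<sigma> the value may
  depend on the fraction chosen. For ring endomorphisms it does not, as they fix the
  integers.\<close>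

definition rat_ext_map :: "('a::comm_ring_1 \<Rightarrow> 'a) \<Rightarrow> 'a rat_ext \<Rightarrow> 'a rat_ext" where
  "rat_ext_map \<sigma> x = (THE y. \<exists>r n. n \<noteq> 0 \<and> x = ifrac r n \<and> y = ifrac (\<sigma> r) n)"

lemma of_nat_ifrac: "of_nat n = ifrac (of_nat n) 1"
  by (induction n) (simp_all add: zero_ifrac one_ifrac add_ifrac)

lemma diff_ifrac:
  "m \<noteq> 0 \<Longrightarrow> n \<noteq> 0 \<Longrightarrow> ifrac r m - ifrac s n = ifrac (of_int n * r - of_int m * s) (m * n)"
  by (simp add: diff_conv_add_uminus uminus_ifrac add_ifrac del: add_uminus_conv_diff)

lemma power_ifrac:
  fixes r :: "'a::char_zero_ring"
  shows "n \<noteq> 0 \<Longrightarrow> ifrac r n ^ k = ifrac (r ^ k) (n ^ k)"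
  by (induction k) (simp_all add: one_ifrac mult_ifrac)

lemma ifrac_cancel: "m \<noteq> 0 \<Longrightarrow> n \<noteq> 0 \<Longrightarrow> ifrac (of_int m * r) (m * n) = ifrac r n"
  by (intro ifrac_eqI) (simp_all add: mult_ac)

lemma diff_ifrac_same: "n \<noteq> 0 \<Longrightarrow> ifrac r n - ifrac s n = ifrac (r - s) n"
  by (simp add: diff_ifrac ifrac_cancel flip: right_diff_distrib)

text \<open>Fermat's little theorem, by induction in both directions from (i + 1)^p = i^p + 1 mod p.
  It takes care of denominators in the Frobenius congruence.\<close>

lemma prime_dvd_power_minus_self:
  assumes p: "prime p"
  shows "int p dvd n ^ p - n"
proof (induction n rule: int_induct[where k = 0])
  case base
  show ?case
    using prime_gt_0_nat[OF p] by (simp add: power_0_left)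
next
  case (step1 i)
  have "int p dvd (i + 1) ^ p - i ^ p - 1"
    using add_power_prime[OF p, of i 1] by simp
  then have "int p dvd ((i + 1) ^ p - i ^ p - 1) + (i ^ p - i)"
    using step1 by (intro dvd_add)
  then show ?case
    by (simp add: algebra_simps)
next
  case (step2 i)
  have "int p dvd i ^ p - (i - 1) ^ p - 1"
    using add_power_prime[OF p, of "i - 1" 1] by simp
  from dvd_diff[OF step2(2) this] show ?case
    by (simp add: algebra_simps)
qed

locale frobenius_ring =
  fixes p :: nat and \<sigma> :: "'a::char_zero_ring \<Rightarrow> 'a"
  assumes prime_p: "prime p" and frobenius_endo: "frobenius_endo p \<sigma>"
begin

lemma
  shows \<sigma>_add: "\<sigma> (r + s) = \<sigma> r + \<sigma> s" and \<sigma>_mult: "\<sigma> (r * s) = \<sigma> r * \<sigma> s" and \<sigma>_one: "\<sigma> 1 = 1"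
    and \<sigma>_cong: "of_nat p dvd \<sigma> r - r ^ p"
  using frobenius_endo by (auto simp: frobenius_endo_def)

lemma \<sigma>_zero: "\<sigma> 0 = 0"
  using \<sigma>_add[of 0 0] by simp

lemma \<sigma>_minus: "\<sigma> (- r) = - \<sigma> r"
  using \<sigma>_add[of r "- r"] by (simp add: \<sigma>_zero eq_neg_iff_add_eq_0 add.commute)

lemma \<sigma>_of_nat: "\<sigma> (of_nat n) = of_nat n"
  by (induction n) (simp_all add: \<sigma>_zero \<sigma>_add \<sigma>_one)

lemma \<sigma>_of_int: "\<sigma> (of_int n) = of_int n"
  by (cases n rule: int_cases2) (simp_all add: \<sigma>_of_nat \<sigma>_minus)

lemma \<sigma>_funpow_one: "(\<sigma> ^^ s) 1 = 1"
  by (induction s) (simp_all add: \<sigma>_one)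

lemma rat_ext_map_ifrac:
  assumes "n \<noteq> 0"
  shows "rat_ext_map \<sigma> (ifrac r n) = ifrac (\<sigma> r) n"
  unfolding rat_ext_map_def
proof (rule the_equality)
  show "\<exists>s m. m \<noteq> 0 \<and> ifrac r n = ifrac s m \<and> ifrac (\<sigma> r) n = ifrac (\<sigma> s) m"
    using assms by blast
next
  fix y
  assume "\<exists>s m. m \<noteq> 0 \<and> ifrac r n = ifrac s m \<and> y = ifrac (\<sigma> s) m"
  then obtain s m where s: "m \<noteq> 0" "ifrac r n = ifrac s m" "y = ifrac (\<sigma> s) m"
    by blast
  then obtain k where k: "k \<noteq> 0" "of_int k * (of_int m * r) = of_int k * (of_int n * s)"
    using assms by (auto simp: ifrac_eq_iff)
  have "of_int k * (of_int m * \<sigma> r) = of_int k * (of_int n * \<sigma> s)"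
    using arg_cong[OF k(2), of \<sigma>] by (simp add: \<sigma>_mult \<sigma>_of_int)
  then have "ifrac (\<sigma> r) n = ifrac (\<sigma> s) m"
    using assms s(1) k(1) by (auto simp: ifrac_eq_iff)
  then show "y = ifrac (\<sigma> r) n"
    using s(3) by simp
qed

lemma rat_ext_map_funpow_ifrac:
  "n \<noteq> 0 \<Longrightarrow> (rat_ext_map \<sigma> ^^ s) (ifrac r n) = ifrac ((\<sigma> ^^ s) r) n"
  by (induction s) (simp_all add: rat_ext_map_ifrac)

lemma p_integralI: "\<not> int p dvd n \<Longrightarrow> ifrac r n \<in> p_integral p"
  by (auto simp: p_integral_def)

lemma p_integralE:
  assumes "x \<in> p_integral p"
  obtains r n where "x = ifrac r n" "\<not> int p dvd n" "n \<noteq> 0"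
  using assms by (force simp: p_integral_def)

lemma prime_int_p: "prime (int p)"
  using prime_p by simp

text \<open>For r/n, the difference \<sigma>(r)/n - (r/n)^p has numerator n^p \<sigma>(r) - n r^p,
  divisible by p since \<sigma>(r) = r^p and n^p = n mod p.\<close>

sublocale L: frobenius_lift "p_integral p :: 'a rat_ext set" "rat_ext_map \<sigma>" p "ifrac 1 (int p)"
proof
  have p0: "int p \<noteq> 0"
    using prime_gt_0_nat[OF prime_p] by simp
  show "prime p"
    by (rule prime_p)
  show "of_nat p * ifrac 1 (int p) = (1 :: 'a rat_ext)"
    using p0 by (simp add: of_nat_ifrac mult_ifrac one_ifrac) (intro ifrac_eqI; simp)
  show "(1 :: 'a rat_ext) \<in> p_integral p"
    unfolding one_ifrac using prime_int_p by (intro p_integralI) auto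
  fix a b :: "'a rat_ext"
  obtain r m where a: "a = ifrac r m" "m \<noteq> 0"
    by (cases a)
  obtain s n where b: "b = ifrac s n" "n \<noteq> 0"
    by (cases b)
  show "rat_ext_map \<sigma> (a + b) = rat_ext_map \<sigma> a + rat_ext_map \<sigma> b"
    by (simp add: a b add_ifrac rat_ext_map_ifrac \<sigma>_add \<sigma>_mult \<sigma>_of_int)
  show "rat_ext_map \<sigma> (a * b) = rat_ext_map \<sigma> a * rat_ext_map \<sigma> b"
    by (simp add: a b mult_ifrac rat_ext_map_ifrac \<sigma>_mult)
  show "rat_ext_map \<sigma> 1 = 1"
    by (simp add: one_ifrac rat_ext_map_ifrac \<sigma>_one)
next
  fix a b :: "'a rat_ext"
  assume "a \<in> p_integral p" "b \<in> p_integral p"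
  then obtain r m s n where *: "a = ifrac r m" "\<not> int p dvd m" "m \<noteq> 0" "b = ifrac s n" "\<not> int p dvd n" "n \<noteq> 0"
    by (metis p_integralE)
  then have "\<not> int p dvd m * n"
    using prime_int_p by (simp add: prime_dvd_mult_iff)
  then show "a - b \<in> p_integral p" "a * b \<in> p_integral p"
    using * by (simp_all add: diff_ifrac mult_ifrac p_integralI)
next
  fix a :: "'a rat_ext"
  assume "a \<in> p_integral p"
  then obtain r n where a: "a = ifrac r n" "\<not> int p dvd n" "n \<noteq> 0"
    by (metis p_integralE)
  then show "rat_ext_map \<sigma> a \<in> p_integral p"
    by (simp add: rat_ext_map_ifrac p_integralI)
  have p0: "int p \<noteq> 0"
    using prime_gt_0_nat[OF prime_p] by simp
  obtain x where x: "\<sigma> r - r ^ p = of_nat p * x"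
    using \<sigma>_cong by blast
  obtain c where c: "n ^ p - n = int p * c"
    using prime_dvd_power_minus_self[OF prime_p] by blast
  have "of_int (n ^ p) * \<sigma> r - of_int n * r ^ p
      = of_int (n ^ p) * (\<sigma> r - r ^ p) + of_int (n ^ p - n) * r ^ p"
    by (simp add: algebra_simps)
  also have "\<dots> = of_int (int p) * (of_int (n ^ p) * x + of_int c * r ^ p)"
    unfolding x c by (simp add: algebra_simps)
  finally have eq: "of_int (n ^ p) * \<sigma> r - of_int n * r ^ p = of_int (int p) * (of_int (n ^ p) * x + of_int c * r ^ p)" .
  have "ifrac 1 (int p) * (rat_ext_map \<sigma> a - a ^ p)
      = ifrac (of_int (n ^ p) * \<sigma> r - of_int n * r ^ p) (int p * (n * n ^ p))"
    using a(3) p0 by (simp add: a(1) rat_ext_map_ifrac power_ifrac diff_ifrac mult_ifrac)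
  also have "\<dots> = ifrac (of_int (n ^ p) * x + of_int c * r ^ p) (n * n ^ p)"
    unfolding eq using a(3) p0 by (intro ifrac_cancel) auto
  also have "\<dots> \<in> p_integral p"
    using a(2) prime_int_p by (intro p_integralI) (auto simp: prime_dvd_mult_iff dest: prime_dvd_power[OF prime_int_p])
  finally show "ifrac 1 (int p) * (rat_ext_map \<sigma> a - a ^ p) \<in> p_integral p" .
qed

text \<open>Torsion-freeness gives n x = p^k r with n prime to p, and a Bezout relation between n
  and p^k makes x a multiple of p^k.\<close>

lemma power_dvd_of_p_integral:
  assumes "ifrac x (int p ^ k) \<in> p_integral p"
  shows "of_nat p ^ k dvd x"
proof -
  have p0: "int p ^ k \<noteq> 0"
    using prime_gt_0_nat[OF prime_p] by simp
  obtain r n where r: "ifrac x (int p ^ k) = ifrac r n" "\<not> int p dvd n" "n \<noteq> 0"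
    using assms by (rule p_integralE)
  then obtain l where l: "l \<noteq> 0" "of_int l * (of_int n * x) = of_int l * (of_int (int p ^ k) * r)"
    unfolding ifrac_eq_iff[OF p0 r(3)] by blast
  then have "of_int l * (of_int n * x - of_int (int p ^ k) * r) = 0"
    by (simp only: right_diff_distrib diff_self)
  then have nx: "of_int n * x = of_int (int p ^ k) * r"
    using char_zero_ring_torsion_free[OF _ l(1)] by fastforce
  have "coprime n (int p ^ k)"
    using r(2) prime_int_p by (metis coprime_commute coprime_power_left_iff prime_imp_coprime_int)
  then obtain u w where "u * n + w * int p ^ k = 1"
    using bezout_int[of n "int p ^ k"] by auto
  then have "x = of_int (u * n + w * int p ^ k) * x"
    by simp
  also have "\<dots> = of_int u * (of_int n * x) + of_int w * of_nat p ^ k * x"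
    by (simp add: distrib_right mult.assoc)
  also have "\<dots> = of_nat p ^ k * (of_int u * r + of_int w * x)"
    unfolding nx by (simp add: algebra_simps)
  finally show ?thesis
    by (metis dvd_triv_left)
qed

end

section \<open>Factorization of sequences\<close>

text \<open>The alternative \<open>s = 1\<close> covers n = 0, whose expansion has length 1.\<close>

lemma plen_eqI:
  assumes "p > 1" "1 \<le> s" "n < p ^ s" "s = 1 \<or> p ^ (s - 1) \<le> n"
  shows "plen p n = s"
  unfolding plen_def
proof (rule Least_equality)
  fix t
  assume t: "1 \<le> t \<and> n < p ^ t"
  show "s \<le> t"
  proof (rule ccontr)
    assume "\<not> s \<le> t"
    then have "p ^ t \<le> p ^ (s - 1)" "s \<noteq> 1"
      using assms(1) t by (auto intro: power_increasing)
    then show False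
      using assms(4) t by simp
  qed
qed (use assms in auto)

lemma power_plen_le:
  assumes "p > 1" "n > 0"
  shows "p ^ (plen p n - 1) \<le> n"
proof (cases "plen p n = 1")
  case False
  then have "plen p n - 1 < plen p n" "1 \<le> plen p n - 1"
    using one_le_plen[OF assms(1), of n] by auto
  then show ?thesis
    using not_less_Least[of "plen p n - 1" "\<lambda>s. 1 \<le> s \<and> n < p ^ s"] by (auto simp: plen_def not_less)
qed (use assms in auto)

text \<open>Explains the range of \<open>splits\<close>: a left factor m \<le> n has length at most
  n + 1.\<close>

lemma plen_le_Suc:
  assumes "p > 1"
  shows "plen p n \<le> Suc n"
proof -
  have "n < p ^ Suc n"
    using power_gt_expt[of p "Suc n"] assms by simp
  then show ?thesis
    unfolding plen_def by (intro Least_le) simp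
qed

lemma plen_0: "p > 1 \<Longrightarrow> plen p 0 = 1"
  by (rule plen_eqI) auto

lemma plen_power_minus_1:
  assumes "p > 1" "k > 0"
  shows "plen p (p ^ k - 1) = k"
proof (rule plen_eqI)
  have "p ^ (k - 1) < p ^ k"
    using assms by (intro power_strict_increasing) auto
  then have "p ^ (k - 1) \<le> p ^ k - 1"
    by linarith
  then show "k = 1 \<or> p ^ (k - 1) \<le> p ^ k - 1"
    by simp
qed (use assms in auto)

lemma pconcat_0: "pconcat p n 0 = n"
  by (simp add: pconcat_def)

lemma plen_pconcat:
  assumes p: "p > 1" and m: "m > 0"
  shows "plen p (pconcat p n m) = plen p n + plen p m"
proof (rule plen_eqI[OF p])
  let ?s = "plen p n" and ?t = "plen p m"
  have "n + m * p ^ ?s < Suc m * p ^ ?s"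
    using less_power_plen[OF p, of n] by simp
  also have "\<dots> \<le> p ^ ?t * p ^ ?s"
    using less_power_plen[OF p, of m] by (intro mult_right_mono) auto
  finally show "pconcat p n m < p ^ (?s + ?t)"
    by (simp add: pconcat_def power_add mult.commute)
  show "1 \<le> ?s + ?t"
    using one_le_plen[OF p, of n] by simp
  have "p ^ (?s + ?t - 1) = p ^ ?s * p ^ (?t - 1)"
    using one_le_plen[OF p, of m] by (simp flip: power_add)
  also have "\<dots> \<le> p ^ ?s * m"
    using power_plen_le[OF p m] by simp
  finally show "?s + ?t = 1 \<or> p ^ (?s + ?t - 1) \<le> pconcat p n m"
    by (simp add: pconcat_def mult.commute)
qed

lemma pconcat_assoc:
  "p > 1 \<Longrightarrow> m > 0 \<Longrightarrow> pconcat p (pconcat p n m) l = pconcat p n (pconcat p m l)"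
  unfolding pconcat_def[of p "pconcat p n m"]
  by (simp add: plen_pconcat) (simp add: pconcat_def power_add algebra_simps)

lemma pconcat_pos: "n > 0 \<Longrightarrow> pconcat p n m > 0"
  by (simp add: pconcat_def)

lemma pconcat_mod_div:
  assumes "p > 1"
  shows "pconcat p m l mod p ^ plen p m = m" "pconcat p m l div p ^ plen p m = l"
  using assms less_power_plen[OF assms, of m] by (simp_all add: pconcat_def)

lemma pconcat_mod_div_eq:
  "plen p (n mod p ^ s) = s \<Longrightarrow> pconcat p (n mod p ^ s) (n div p ^ s) = n"
  by (simp add: pconcat_def mod_div_mult_eq)

lemma pconcat_list_Cons: "pconcat_list p (n # ns) = pconcat p n (pconcat_list p ns)"
  by (simp add: pconcat_list_def)

text \<open>\<open>pconcat_list\<close> nests to the right, so splitting off the last factor needs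
  associativity; lengths add because all factors of \<open>ns\<close> after the first are
  positive.\<close>

lemma pconcat_list_snoc:
  assumes p: "p > 1"
  shows "ns \<noteq> [] \<Longrightarrow> \<forall>m \<in> set (tl ns). 0 < m \<Longrightarrow>
    pconcat_list p (ns @ [l]) = pconcat p (pconcat_list p ns) l \<and>
    plen p (pconcat_list p ns) = sum_list (map (plen p) ns)"
proof (induction ns)
  case (Cons n ns)
  show ?case
  proof (cases ns)
    case Nil
    then show ?thesis
      by (simp add: pconcat_list_def pconcat_0)
  next
    case (Cons m ms)
    then have "pconcat_list p ns > 0"
      using Cons.prems by (simp add: pconcat_list_Cons pconcat_pos)
    moreover have "pconcat_list p (ns @ [l]) = pconcat p (pconcat_list p ns) l"
      "plen p (pconcat_list p ns) = sum_list (map (plen p) ns)"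
      using Cons.IH Cons.prems Cons by auto
    ultimately show ?thesis
      using p by (simp add: pconcat_list_Cons pconcat_assoc plen_pconcat)
  qed
qed simp

section \<open>Summation over the factorizations of n\<close>

definition splits :: "nat \<Rightarrow> nat \<Rightarrow> nat set" where
  "splits p n = {s \<in> {1..Suc n}. plen p (n mod p ^ s) = s}"

text \<open>The number \<open>n = m * l\<close> determines \<open>m = n mod p\<^sup>s\<close> and \<open>l = n div p\<^sup>s\<close> from \<open>s = \<ell>(m)\<close>, so
  \<^const>\<open>splits\<close> runs over all such factorizations, with \<open>l = 0\<close> exactly for \<open>s = \<ell>(n)\<close>.\<close>

definition p_factorizes :: "nat \<Rightarrow> ('a::comm_ring_1 \<Rightarrow> 'a) \<Rightarrow> (nat \<Rightarrow> 'a) \<Rightarrow> (nat \<Rightarrow> 'a) \<Rightarrow> bool" where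
  "p_factorizes p \<sigma> b c \<longleftrightarrow>
     (\<forall>n. b n = (\<Sum>s\<in>splits p n. c (n mod p ^ s) * (\<sigma> ^^ s) (b (n div p ^ s))))"

lemma splits_eq_insert:
  assumes "p > 1"
  shows "splits p n = insert (plen p n) {s \<in> splits p n. n div p ^ s > 0}"
proof -
  have "n mod p ^ plen p n = n"
    using less_power_plen[OF assms, of n] by simp
  then have "plen p n \<in> splits p n"
    using one_le_plen[OF assms, of n] plen_le_Suc[OF assms, of n] by (simp add: splits_def)
  moreover have "s = plen p n" if "s \<in> splits p n" "n div p ^ s = 0" for s
  proof -
    have "n mod p ^ s = n"
      using that(2) assms by (auto simp: div_eq_0_iff)
    then show ?thesis
      using that(1) by (simp add: splits_def)
  qed
  ultimately show ?thesis
    by blast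
qed

lemma sum_splits:
  assumes "p > 1"
  shows "(\<Sum>s\<in>splits p n. g s) = g (plen p n) + (\<Sum>s\<in>{s \<in> splits p n. n div p ^ s > 0}. g s)"
proof -
  have "n div p ^ plen p n = 0"
    using less_power_plen[OF assms, of n] by simp
  moreover have "finite {s \<in> splits p n. n div p ^ s > 0}"
    by (rule finite_subset[of _ "{1..Suc n}"]) (auto simp: splits_def)
  ultimately show ?thesis
    by (subst splits_eq_insert[OF assms], subst sum.insert) auto
qed

context frobenius_ring
begin

lemma p_gt_1: "p > 1"
  using prime_gt_1_nat[OF prime_p] .

text \<open>Peels off the last factor of each decomposition.\<close>

lemma p_factorizes_p_sequence:
  assumes b: "b 0 = 1"
  shows "p_factorizes p \<sigma> b (p_sequence p \<sigma> b)"
proof -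
  define w where "w ns = (- 1) ^ (length ns - 1) *
    (\<Prod>i<length ns. (\<sigma> ^^ (\<Sum>j<i. plen p (ns ! j))) (b (ns ! i)))" for ns
  have c: "p_sequence p \<sigma> b n = sum w (p_decomps p n)" for n
    by (simp add: p_sequence_def w_def)
  \<comment> \<open>A new last factor flips the sign and is twisted by the total length of the
    earlier ones, which is the length of their concatenation.\<close>
  have w_snoc: "w (ms @ [l]) = - (w ms * (\<sigma> ^^ plen p m) (b l))" if "ms \<in> p_decomps p m" for ms m l
  proof -
    have ms: "ms \<noteq> []" "\<forall>m \<in> set (tl ms). 0 < m" "pconcat_list p ms = m"
      using that by (simp_all add: p_decomps_def)
    have len: "plen p m = (\<Sum>j<length ms. plen p (ms ! j))"
      using pconcat_list_snoc[OF p_gt_1 ms(1,2)] ms(3)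
      by (simp add: sum_list_sum_nth atLeast0LessThan)
    obtain k where k: "length ms = Suc k"
      using ms(1) by (cases ms) auto
    show ?thesis
      unfolding w_def len by (simp add: k nth_append)
  qed
  have "p_sequence p \<sigma> b n = b n - (\<Sum>s\<in>{s \<in> splits p n. n div p ^ s > 0}.
      p_sequence p \<sigma> b (n mod p ^ s) * (\<sigma> ^^ s) (b (n div p ^ s)))" for n
  proof -
    let ?S = "{s \<in> splits p n. n div p ^ s > 0}"
    have fin: "finite (p_decomps p m)" for m
      by (rule finite_p_decomps[OF p_gt_1])
    have finS: "finite ?S"
      by (rule finite_subset[of _ "{1..Suc n}"]) (auto simp: splits_def)
    have n_mem: "[n] \<in> p_decomps p n"
      by (simp add: p_decomps_def pconcat_list_def pconcat_0)
    \<comment> \<open>Every decomposition but [n] is a decomposition of some m followed by a last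
      factor l > 0, and s = \<open>plen p m\<close> recovers m and l from n.\<close>
    have "sum w (p_decomps p n - {[n]}) =
        (\<Sum>(s, ms)\<in>(SIGMA s:?S. p_decomps p (n mod p ^ s)).
          - (w ms * (\<sigma> ^^ s) (b (n div p ^ s))))"
    proof (rule sum.reindex_bij_witness[where
        i = "\<lambda>(s, ms). ms @ [n div p ^ s]" and
        j = "\<lambda>ns. (plen p (pconcat_list p (butlast ns)), butlast ns)"])
      fix ns
      assume "ns \<in> p_decomps p n - {[n]}"
      then have ns: "ns \<noteq> []" "\<forall>m \<in> set (tl ns). 0 < m" "pconcat_list p ns = n" "ns \<noteq> [n]"
        by (auto simp: p_decomps_def)
      obtain ms l where ms_l: "ns = ms @ [l]"
        using ns(1) by (metis append_butlast_last_id)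
      have "ms \<noteq> []"
      proof
        assume "ms = []"
        then show False
          using ns(3,4) by (simp add: ms_l pconcat_list_def pconcat_0)
      qed
      then have pos: "l > 0" "\<forall>m \<in> set (tl ms). 0 < m"
        using ns(2) by (auto simp: ms_l)
      define m where "m = pconcat_list p ms"
      have n: "n = pconcat p m l"
        using pconcat_list_snoc[OF p_gt_1 \<open>ms \<noteq> []\<close> pos(2), of l] ns(3) by (simp add: ms_l m_def)
      have ml: "n mod p ^ plen p m = m" "n div p ^ plen p m = l"
        unfolding n by (rule pconcat_mod_div[OF p_gt_1])+
      have "m \<le> n"
        by (simp add: n pconcat_def)
      then have "plen p m \<in> ?S"
        using one_le_plen[OF p_gt_1, of m] plen_le_Suc[OF p_gt_1, of m] pos(1) ml by (simp add: splits_def)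
      moreover have ms_mem: "ms \<in> p_decomps p m"
        using \<open>ms \<noteq> []\<close> pos(2) by (simp add: p_decomps_def m_def)
      ultimately show
        "(plen p (pconcat_list p (butlast ns)), butlast ns) \<in> (SIGMA s:?S. p_decomps p (n mod p ^ s))"
        "(case (plen p (pconcat_list p (butlast ns)), butlast ns) of (s, ms) \<Rightarrow> ms @ [n div p ^ s]) = ns"
        "(case (plen p (pconcat_list p (butlast ns)), butlast ns) of
          (s, ms) \<Rightarrow> - (w ms * (\<sigma> ^^ s) (b (n div p ^ s)))) = w ns"
        using ml w_snoc[OF ms_mem, of l] by (simp_all add: ms_l flip: m_def)
    next
      fix x
      assume "x \<in> (SIGMA s:?S. p_decomps p (n mod p ^ s))"
      then obtain s ms where x: "x = (s, ms)" "s \<in> ?S" "ms \<in> p_decomps p (n mod p ^ s)"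
        by auto
      then have ms: "ms \<noteq> []" "\<forall>m \<in> set (tl ms). 0 < m" "pconcat_list p ms = n mod p ^ s"
        and s: "plen p (n mod p ^ s) = s" "n div p ^ s > 0"
        by (simp_all add: p_decomps_def splits_def)
      have "pconcat_list p (ms @ [n div p ^ s]) = n"
        using pconcat_list_snoc[OF p_gt_1 ms(1,2)] ms(3) s(1) by (simp add: pconcat_mod_div_eq)
      then show "(case x of (s, ms) \<Rightarrow> ms @ [n div p ^ s]) \<in> p_decomps p n - {[n]}"
        using ms(1,2) s(2) by (auto simp: x(1) p_decomps_def)
      show "(plen p (pconcat_list p (butlast (case x of (s, ms) \<Rightarrow> ms @ [n div p ^ s]))),
          butlast (case x of (s, ms) \<Rightarrow> ms @ [n div p ^ s])) = x"
        by (simp add: x(1) ms(3) s(1))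
    qed
    also have "\<dots> = (\<Sum>s\<in>?S. \<Sum>ms\<in>p_decomps p (n mod p ^ s). - (w ms * (\<sigma> ^^ s) (b (n div p ^ s))))"
      using finS fin by (subst sum.Sigma) auto
    also have "\<dots> = - (\<Sum>s\<in>?S. p_sequence p \<sigma> b (n mod p ^ s) * (\<sigma> ^^ s) (b (n div p ^ s)))"
      by (simp add: c sum_negf sum_distrib_right)
    finally show ?thesis
      using sum.remove[OF fin n_mem, of w] by (simp add: c w_def)
  qed
  then have *: "b n = p_sequence p \<sigma> b n + (\<Sum>s\<in>{s \<in> splits p n. n div p ^ s > 0}.
      p_sequence p \<sigma> b (n mod p ^ s) * (\<sigma> ^^ s) (b (n div p ^ s)))" for n
    by (simp add: algebra_simps)
  have **: "p_sequence p \<sigma> b (n mod p ^ plen p n) * (\<sigma> ^^ plen p n) (b (n div p ^ plen p n))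
      = p_sequence p \<sigma> b n" for n
    using less_power_plen[OF p_gt_1, of n] by (simp add: b \<sigma>_funpow_one)
  show ?thesis
    unfolding p_factorizes_def sum_splits[OF p_gt_1] ** by (intro allI *)
qed

end

section \<open>The two implications\<close>

lemma splits_0: "p > 1 \<Longrightarrow> splits p 0 = {1}"
  using plen_0[of p] by (auto simp: splits_def)

lemma one_less_power_splits: "p > 1 \<Longrightarrow> s \<in> splits p n \<Longrightarrow> 1 < p ^ s"
  by (rule one_less_power) (auto simp: splits_def)

text \<open>Inverts the passage from b to c. The guard \<open>p \<le> 1\<close> secures termination,
  which needs p^s > 1.\<close>

function p_unfactorize :: "nat \<Rightarrow> ('a::comm_ring_1 \<Rightarrow> 'a) \<Rightarrow> (nat \<Rightarrow> 'a) \<Rightarrow> nat \<Rightarrow> 'a" where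
  "p_unfactorize p \<sigma> c n = (if n = 0 \<or> p \<le> 1 then 1 else
     \<Sum>s\<in>splits p n. c (n mod p ^ s) * (\<sigma> ^^ s) (p_unfactorize p \<sigma> c (n div p ^ s)))"
  by auto
termination
proof (relation "measure (\<lambda>(p, \<sigma>, c, n). n)")
  fix p n s :: nat and \<sigma> :: "'a \<Rightarrow> 'a" and c :: "nat \<Rightarrow> 'a"
  assume "\<not> (n = 0 \<or> p \<le> 1)" "s \<in> splits p n"
  then have "n > 0" "1 < p ^ s"
    using one_less_power_splits[of p s n] by auto
  then show "((p, \<sigma>, c, n div p ^ s), p, \<sigma>, c, n) \<in> measure (\<lambda>(p, \<sigma>, c, n). n)"
    by simp
qed simp

declare p_unfactorize.simps [simp del]

lemma one_plus_X_power_nth: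
  "((1 + fps_X) ^ n :: 'a::comm_ring_1 fps) $ k = of_nat (n choose k)"
proof (induction n arbitrary: k)
  case (Suc n)
  then show ?case
    by (cases k) (simp_all add: distrib_right)
qed (simp add: binomial_eq_0)

text \<open>For 0 < j < p^k the numbers m p^k - j and p^k - j have the same p-adic valuation, so
  these valuations cancel in the binomial coefficient.\<close>

lemma prime_not_dvd_choose_pred:
  fixes p :: nat
  assumes p: "prime p" and m: "m > 0"
  shows "\<not> p dvd (m * p ^ k - 1) choose (p ^ k - 1)"
proof -
  have le: "p ^ k \<le> p ^ k * m" "0 < p ^ k" "p \<noteq> 0"
    using m prime_gt_0_nat[OF p] by auto
  have "multiplicity p ((p ^ k * m - 1) choose (p ^ k - 1)) = 0"
  proof (rule p_not_div_choose[where K = "p ^ k"])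
    fix j
    assume j: "0 < j" "j < p ^ k"
    then have "p ^ k * m - 1 - (p ^ k - 1) + (p ^ k - j) = p ^ k * m - j"
      using le by simp
    then show "multiplicity p (p ^ k * m - 1 - (p ^ k - 1) + (p ^ k - j)) = multiplicity p (p ^ k - j)"
      using exponent_p_a_m_k_equation[OF m j(1) le(3) j(2)] by simp
  next
    show "p ^ k - 1 < p ^ k"
      using le(2) by linarith
    show "p ^ k - 1 \<le> p ^ k * m - 1"
      using le(1) by linarith
  qed (rule p)
  moreover have "(p ^ k * m - 1) choose (p ^ k - 1) \<noteq> 0"
    using le(1,2) unfolding binomial_eq_0_iff by linarith
  ultimately show ?thesis
    using p by (metis mult.commute multiplicity_eq_zero_iff not_prime_unit)
qed

lemma ifrac_sum: "n \<noteq> 0 \<Longrightarrow> ifrac (sum f I) n = (\<Sum>i\<in>I. ifrac (f i) n)"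
proof (induction I rule: infinite_finite_induct)
  case (insert i I)
  have "ifrac (f i + sum f I) n = ifrac (f i) n + ifrac (sum f I) n"
    using insert.prems by (auto simp: add_ifrac algebra_simps intro!: ifrac_eqI)
  then show ?case
    using insert by simp
qed (auto simp: zero_ifrac intro!: ifrac_eqI)

lemma log_series_nth_Suc: "log_series b $ Suc n = ifrac (b n) (int (Suc n))"
  by (simp add: log_series_def)

lemma log_series_0_1:
  assumes "b 0 = 1"
  shows "log_series b $ 0 = 0" "log_series b $ 1 = 1"
  using assms by (simp_all add: log_series_def one_ifrac)

context frobenius_ring
begin

lemma p_unfactorize:
  assumes c: "c 0 = 1"
  shows "p_unfactorize p \<sigma> c 0 = 1" "p_factorizes p \<sigma> (p_unfactorize p \<sigma> c) c"
proof -
  show 0: "p_unfactorize p \<sigma> c 0 = 1"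
    by (simp add: p_unfactorize.simps)
  have "p_unfactorize p \<sigma> c n = (\<Sum>s\<in>splits p n. c (n mod p ^ s) * (\<sigma> ^^ s) (p_unfactorize p \<sigma> c (n div p ^ s)))" for n
  proof (cases "n = 0")
    case False
    then show ?thesis
      using p_gt_1 by (subst p_unfactorize.simps) simp
  qed (simp add: 0 c splits_0[OF p_gt_1] \<sigma>_one)
  then show "p_factorizes p \<sigma> (p_unfactorize p \<sigma> c) c"
    unfolding p_factorizes_def by blast
qed

text \<open>As c and c' agree below n, so do b and b' by induction. In degree n the factorizations
  with l > 0 then cancel, and the one with l = 0 contributes \<open>c n\<close>.\<close>

lemma p_factorizes_diff:
  assumes b: "b 0 = 1" "p_factorizes p \<sigma> b c" and b': "b' 0 = 1" "p_factorizes p \<sigma> b' c'"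
    and eq: "\<And>i. i < n \<Longrightarrow> c i = c' i" and n: "n > 0"
  shows "b n - b' n = c n - c' n"
proof -
  have step: "b k - b' k = c k - c' k"
    if k: "k > 0" "\<And>i. i < k \<Longrightarrow> b i = b' i" "\<And>i. i < k \<Longrightarrow> c i = c' i" for k
  proof -
    have lt: "k div p ^ s < k" "k mod p ^ s < k" if "s \<in> splits p k" "k div p ^ s > 0" for s
    proof -
      have "1 < p ^ s"
        using one_less_power_splits[OF p_gt_1 that(1)] .
      then show "k div p ^ s < k" "k mod p ^ s < k"
        using k(1) that(2) mod_less_divisor[of "p ^ s" k]
        by (auto simp: div_greater_zero_iff simp del: mod_less_divisor)
    qed
    have "(\<Sum>s\<in>{s \<in> splits p k. k div p ^ s > 0}. c (k mod p ^ s) * (\<sigma> ^^ s) (b (k div p ^ s)))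
        = (\<Sum>s\<in>{s \<in> splits p k. k div p ^ s > 0}. c' (k mod p ^ s) * (\<sigma> ^^ s) (b' (k div p ^ s)))"
      using lt k(2,3) by (intro sum.cong) auto
    moreover have "k mod p ^ plen p k = k" "k div p ^ plen p k = 0"
      using less_power_plen[OF p_gt_1, of k] by simp_all
    moreover have "b k = (\<Sum>s\<in>splits p k. c (k mod p ^ s) * (\<sigma> ^^ s) (b (k div p ^ s)))"
      "b' k = (\<Sum>s\<in>splits p k. c' (k mod p ^ s) * (\<sigma> ^^ s) (b' (k div p ^ s)))"
      using b(2) b'(2) unfolding p_factorizes_def by blast+
    ultimately show ?thesis
      unfolding sum_splits[OF p_gt_1] by (simp add: b(1) b'(1) \<sigma>_funpow_one)
  qed
  have "b k = b' k" if "k < n" for k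
    using that
  proof (induction k rule: less_induct)
    case (less k)
    show ?case
    proof (cases "k = 0")
      case False
      then have "b k - b' k = c k - c' k"
        using less eq by (intro step) auto
      then show ?thesis
        using eq less.prems by simp
    qed (simp add: b(1) b'(1))
  qed
  then show ?thesis
    using eq n by (intro step) auto
qed

text \<open>The factorizations \<open>n = m * l\<close> with \<open>m = p\<^sup>s - 1\<close> are the terms of the functional equation;
  in all the others the divisibility of \<open>c m\<close> cancels the power of \<open>p\<close> in the denominator \<open>n + 1\<close>.\<close>

lemma total_fgl_integral_if:
  assumes b: "b 0 = 1" "p_factorizes p \<sigma> b c"
    and c: "\<And>m k. m > 1 \<Longrightarrow> of_nat p ^ k dvd c (m * p ^ k - 1)"
  shows "total_fgl (log_series b) \<in> coeffs_in (coeffs_in (p_integral p))"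
proof -
  \<comment> \<open>The hypothesis with m = p yields p^s for the index p^(s+1) - 1, as m = 1 is
    excluded; hence the shift in \<open>v\<close>.\<close>
  have "\<exists>x. c (p ^ Suc s - 1) = of_nat p ^ s * x" for s
    using c[of p s] p_gt_1 by (auto simp: mult.commute elim!: dvdE)
  then obtain x where x: "\<And>s. c (p ^ Suc s - 1) = of_nat p ^ s * x s"
    by metis
  define v where "v s = ifrac (x (s - 1)) 1" for s
  have one: "ifrac r 1 \<in> p_integral p" for r
    using prime_int_p by (intro p_integralI) auto
  show ?thesis
  proof (rule L.total_fgl_integral[where v = v])
    show "v s \<in> p_integral p" for s
      by (simp add: v_def one)
    show "log_series b $ 0 = 0" "log_series b $ 1 = 1"
      using log_series_0_1[of b] b(1) by simp_all
    show "L.fe_defect v (log_series b) N \<in> p_integral p" for N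
    proof (cases N)
      case 0
      then show ?thesis
        using L.zero_mem by (simp add: L.fe_defect_def log_series_def)
    next
      case (Suc n)
      let ?g = "\<lambda>s. ifrac (c (n mod p ^ s) * (\<sigma> ^^ s) (b (n div p ^ s))) (int N)"
      let ?f = "log_series b"
      have N0: "N \<noteq> 0" "int N \<noteq> 0"
        by (simp_all add: Suc)
      have fin: "finite (splits p n)"
        by (simp add: splits_def)
      \<comment> \<open>If p^s divides N = n + 1, then n mod p^s is p^s - 1, of length s, and the
        corresponding summand of b n is the s-th Frobenius term.\<close>
      have split: "s \<in> splits p n" "v s * (ifrac 1 (int p) * (frob_fps p (rat_ext_map \<sigma>) ^^ s) ?f $ N) = ?g s"
        if s: "s \<in> {1..N}" "p ^ s dvd N" for s
      proof -
        obtain l where l: "N = p ^ s * l"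
          using s(2) ..
        have "l > 0"
          using N0(1) l by (cases l) auto
        then obtain j where j: "l = Suc j"
          by (cases l) auto
        have ps: "p ^ s > 0"
          using p_gt_1 by simp
        have "Suc n = p ^ s + j * p ^ s"
          using l by (simp add: Suc j mult.commute)
        then have n: "n = (p ^ s - 1) + j * p ^ s"
          using ps by linarith
        then have nm: "n mod p ^ s = p ^ s - 1" "n div p ^ s = j"
          using ps by (simp_all add: n)
        then show "s \<in> splits p n"
          using s(1) plen_power_minus_1[OF p_gt_1, of s] by (simp add: splits_def Suc)
        obtain t where t: "s = Suc t"
          using s(1) by (cases s) auto
        have l': "int l \<noteq> 0"
          using j by simp
        have "?f $ l = ifrac (b j) (int l)"
          by (simp add: j log_series_nth_Suc)
        then have "v s * (ifrac 1 (int p) * (frob_fps p (rat_ext_map \<sigma>) ^^ s) ?f $ N)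
            = ifrac (x t * (\<sigma> ^^ s) (b j)) (int p * int l)"
          using s(2) ps l' p_gt_1
          by (simp add: L.frob_nth l v_def t rat_ext_map_funpow_ifrac mult_ifrac del: funpow.simps)
        also have "\<dots> = ifrac (of_int (int p ^ t) * (x t * (\<sigma> ^^ s) (b j))) (int p ^ t * (int p * int l))"
          using p_gt_1 l' by (intro ifrac_cancel[symmetric]) auto
        also have "\<dots> = ?g s"
          using x[of t] nm by (simp add: l t mult_ac)
        finally show "v s * (ifrac 1 (int p) * (frob_fps p (rat_ext_map \<sigma>) ^^ s) ?f $ N) = ?g s" .
      qed
      have "(\<Sum>s\<in>{1..N}. v s * (ifrac 1 (int p) * (frob_fps p (rat_ext_map \<sigma>) ^^ s) ?f $ N))
          = (\<Sum>s\<in>{s \<in> {1..N}. p ^ s dvd N}. v s * (ifrac 1 (int p) * (frob_fps p (rat_ext_map \<sigma>) ^^ s) ?f $ N))"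
        by (intro sum.mono_neutral_right) (auto simp: L.frob_nth)
      also have "\<dots> = (\<Sum>s\<in>{s \<in> {1..N}. p ^ s dvd N}. ?g s)"
        using split(2) by (intro sum.cong) auto
      also have "{s \<in> {1..N}. p ^ s dvd N} = {s \<in> splits p n. p ^ s dvd N}"
        using split(1) by (auto simp: splits_def Suc)
      finally have "L.fe_defect v ?f N = ?f $ N - (\<Sum>s\<in>{s \<in> splits p n. p ^ s dvd N}. ?g s)"
        by (simp add: L.fe_defect_def)
      also have "?f $ N = ifrac (b n) (int N)"
        by (simp add: Suc log_series_nth_Suc)
      also have "b n = (\<Sum>s\<in>splits p n. c (n mod p ^ s) * (\<sigma> ^^ s) (b (n div p ^ s)))"
        using b(2) unfolding p_factorizes_def by blast
      also have "ifrac \<dots> (int N) = (\<Sum>s\<in>splits p n. ?g s)"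
        by (rule ifrac_sum[OF N0(2)])
      also have "\<dots> = (\<Sum>s\<in>{s \<in> splits p n. p ^ s dvd N}. ?g s) + (\<Sum>s\<in>splits p n - {s \<in> splits p n. p ^ s dvd N}. ?g s)"
        using fin by (intro sum.subset_diff[THEN trans, OF _ _ add.commute]) auto
      finally have eq: "L.fe_defect v ?f N = (\<Sum>s\<in>splits p n - {s \<in> splits p n. p ^ s dvd N}. ?g s)"
        by simp
      obtain k M where N: "N = p ^ k * M" "\<not> p dvd M"
        using exists_power_times_coprime[OF prime_p, of N] N0(1) by auto
      have "?g s \<in> p_integral p" if s: "s \<in> splits p n" "\<not> p ^ s dvd N" for s
      proof -
        have "k < s"
        proof (rule ccontr)
          assume "\<not> k < s"
          then show False
            using s(2) by (simp add: N(1) le_imp_power_dvd)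
        qed
        \<comment> \<open>The residue of N mod p^s is p^k m, so that of n = N - 1 is m p^k - 1, the
          form to which the divisibility hypothesis applies.\<close>
        define m where "m = M mod p ^ (s - k)"
        have "N mod p ^ s = p ^ k * m"
          using \<open>k < s\<close> by (simp add: N(1) m_def mult_mod_right flip: power_add)
        moreover have "N mod p ^ s = Suc (n mod p ^ s)"
          using s(2) by (auto simp: Suc mod_Suc dvd_eq_mod_eq_0 split: if_splits)
        ultimately have nm: "n mod p ^ s = m * p ^ k - 1" "m > 0"
          by (auto simp: mult.commute intro!: Nat.gr0I)
        have "of_nat p ^ k dvd c (n mod p ^ s)"
        proof (cases "m > 1 \<or> k = 0")
          case True
          then show ?thesis
            using c[of m k] nm by auto
        next
          case False
          \<comment> \<open>Here n mod p^s would be p^k - 1, of length k < s, contrary to s in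
            \<open>splits p n\<close>.\<close>
          then have "m = 1" "k > 0"
            using nm(2) by auto
          then have "plen p (n mod p ^ s) = k"
            using nm(1) plen_power_minus_1[OF p_gt_1, of k] by simp
          then show ?thesis
            using s(1) \<open>k < s\<close> by (simp add: splits_def)
        qed
        then obtain y where y: "c (n mod p ^ s) = of_nat p ^ k * y" ..
        have "?g s = ifrac (of_int (int p ^ k) * (y * (\<sigma> ^^ s) (b (n div p ^ s)))) (int p ^ k * int M)"
          by (simp add: y N(1) mult.assoc)
        also have "\<dots> = ifrac (y * (\<sigma> ^^ s) (b (n div p ^ s))) (int M)"
          using p_gt_1 N0(1) N(1) by (intro ifrac_cancel) auto
        also have "\<dots> \<in> p_integral p"
          using N(2) by (intro p_integralI) simp
        finally show ?thesis .
      qed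
      then show ?thesis
        unfolding eq by (intro L.sum_mem) auto
    qed
  qed
qed

text \<open>Truncating \<open>c\<close> before its \<open>n\<close>-th entry yields a comparison group law that is integral by the
  converse. The two laws first differ in total degree \<open>n + 1\<close>, by a multiple of
  \<open>x\<^bsup>n+1\<^esup> + y\<^bsup>n+1\<^esup> - (x + y)\<^bsup>n+1\<^esup>\<close>.\<close>

lemma power_dvd_if_total_fgl_integral:
  assumes b: "b 0 = 1" "p_factorizes p \<sigma> b c"
    and F: "total_fgl (log_series b) \<in> coeffs_in (coeffs_in (p_integral p))"
  shows "m > 1 \<Longrightarrow> of_nat p ^ k dvd c (m * p ^ k - 1)"
proof (induction "m * p ^ k" arbitrary: m k rule: less_induct)
  case less
  define n where "n = m * p ^ k - 1"
  have pk: "p ^ k > 0"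
    using p_gt_1 by simp
  then have "1 * p ^ k < m * p ^ k"
    using less.prems unfolding mult_less_cancel2 by blast
  then have N: "m * p ^ k = Suc n" and n: "n > 0" "p ^ k < Suc n"
    using pk unfolding n_def by linarith+
  have "b 0 = (\<Sum>s\<in>splits p 0. c (0 mod p ^ s) * (\<sigma> ^^ s) (b (0 div p ^ s)))"
    using b(2) unfolding p_factorizes_def by blast
  then have c0: "c 0 = 1"
    by (simp add: splits_0[OF p_gt_1] b(1) \<sigma>_one)
  define c' where "c' i = (if i < n then c i else 0)" for i
  define b' where "b' = p_unfactorize p \<sigma> c'"
  have b': "b' 0 = 1" "p_factorizes p \<sigma> b' c'"
    unfolding b'_def using p_unfactorize[of c'] c0 n by (simp_all add: c'_def)
  have "total_fgl (log_series b') \<in> coeffs_in (coeffs_in (p_integral p))"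
  proof (rule total_fgl_integral_if[OF b'])
    fix m' k' :: nat
    assume "m' > 1"
    \<comment> \<open>Indices below n are covered by the induction hypothesis; from n on the entry
      is 0.\<close>
    then show "of_nat p ^ k' dvd c' (m' * p ^ k' - 1)"
      using less.hyps[of m' k'] by (auto simp: c'_def N)
  qed
  \<comment> \<open>At u^(p^k), with 0 < p^k < n + 1, the polynomial 1 + u^(n+1) - (1 + u)^(n+1)
    contributes only minus the binomial coefficient.\<close>
  then have mem: "(total_fgl (log_series b) $ Suc n - total_fgl (log_series b') $ Suc n) $ (p ^ k) \<in> p_integral p"
    using F by (auto simp: coeffs_in_def intro: L.diff_mem)
  have eq: "b i - b' i = c i - c' i" if "i \<le> n" "i > 0" for i
    using that by (intro p_factorizes_diff[OF b b']) (auto simp: c'_def)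
  have "b i = b' i" if "i < n" for i
    using eq[of i] that by (cases "i = 0") (auto simp: b(1) b'(1) c'_def)
  then have "log_series b $ i = log_series b' $ i" if "i < Suc n" for i
    using that by (cases i) (auto simp: log_series_nth_Suc log_series_def)
  then have "total_fgl (log_series b) $ Suc n - total_fgl (log_series b') $ Suc n
      = fps_const (log_series b $ Suc n - log_series b' $ Suc n) * (1 + fps_X ^ Suc n - (1 + fps_X) ^ Suc n)"
    using n(1) by (intro total_fgl_nth_diff log_series_0_1 b(1) b'(1)) auto
  also have "log_series b $ Suc n - log_series b' $ Suc n = ifrac (c n) (int (Suc n))"
    using eq[of n] n(1) by (simp add: log_series_nth_Suc diff_ifrac_same c'_def)
  finally have mem': "of_nat (Suc n choose p ^ k) * ifrac (c n) (int (Suc n)) \<in> p_integral p"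
    using L.uminus_mem[OF mem] n(2) p_gt_1
    by (simp add: one_plus_X_power_nth fps_X_power_nth mult.commute del: binomial_Suc_Suc power_Suc)
  define \<beta> where "\<beta> = n choose (p ^ k - 1)"
  have "\<not> p dvd \<beta>"
    using prime_not_dvd_choose_pred[OF prime_p, of m k] less.prems unfolding \<beta>_def n_def by simp
  then have \<beta>: "\<not> p dvd \<beta>" "\<beta> \<noteq> 0"
    by (auto intro: Nat.gr0I)
  \<comment> \<open>Absorption shows the binomial coefficient to be m * \<beta>; then m cancels
    against the denominator m p^k, and \<beta> is prime to p.\<close>
  have "p ^ k * (Suc n choose p ^ k) = Suc n * \<beta>"
    using times_binomial_minus1_eq[OF pk, of "Suc n"] by (simp add: \<beta>_def del: binomial_Suc_Suc)
  then have "p ^ k * (Suc n choose p ^ k) = p ^ k * (m * \<beta>)"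
    unfolding N[symmetric] by (simp add: mult_ac)
  then have binom: "Suc n choose p ^ k = m * \<beta>"
    using p_gt_1 by simp
  have "of_nat (m * \<beta>) * ifrac (c n) (int (Suc n)) = ifrac (of_int (int m) * (of_nat \<beta> * c n)) (int m * int p ^ k)"
    using less.prems p_gt_1 by (simp add: of_nat_ifrac mult_ifrac mult.assoc flip: N)
  also have "\<dots> = ifrac (of_nat \<beta> * c n) (int p ^ k)"
    using less.prems p_gt_1 by (intro ifrac_cancel) auto
  finally have "ifrac (of_nat \<beta> * c n) (int p ^ k) \<in> p_integral p"
    using mem' by (simp only: binom)
  moreover have "ifrac 1 (int \<beta>) \<in> p_integral p"
    using \<beta>(1) by (intro p_integralI) simp
  ultimately have "ifrac 1 (int \<beta>) * ifrac (of_nat \<beta> * c n) (int p ^ k) \<in> p_integral p"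
    by (intro L.mult_mem)
  also have "ifrac 1 (int \<beta>) * ifrac (of_nat \<beta> * c n) (int p ^ k) = ifrac (of_int (int \<beta>) * c n) (int \<beta> * int p ^ k)"
    using \<beta>(2) p_gt_1 by (simp add: mult_ifrac)
  also have "\<dots> = ifrac (c n) (int p ^ k)"
    using \<beta>(2) p_gt_1 by (intro ifrac_cancel) auto
  finally show ?case
    unfolding n_def[symmetric] by (rule power_dvd_of_p_integral)
qed

end

theorem theorem1:
  fixes p :: nat
    and \<sigma> :: "'a::char_zero_ring \<Rightarrow> 'a"
    and b :: "nat \<Rightarrow> 'a"
  assumes "prime p"
    and "frobenius_endo p \<sigma>"
    and "b 0 = 1"
  shows "(\<forall>i j. fps_nth (fps_nth (formal_group_law (log_series b)) j) i \<in> p_integral p) \<longleftrightarrow>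
    (\<forall>m k. m > 1 \<longrightarrow> of_nat p ^ k dvd p_sequence p \<sigma> b (m * p ^ k - 1))"
proof -
  interpret frobenius_ring p \<sigma>
    by unfold_locales (use assms in auto)
  have "p_factorizes p \<sigma> b (p_sequence p \<sigma> b)"
    using assms(3) by (rule p_factorizes_p_sequence)
  then show ?thesis
    using total_fgl_integral_if[of b] power_dvd_if_total_fgl_integral[of b] assms(3)
    unfolding total_fgl_in_iff[OF L.zero_mem, symmetric] by blast
qed

end
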